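(* Let $\mathcal{A}$ be a parametric linear multi-rate automaton (PLMA) with set of accepting locations $F$. Assume that there exists a parameter valuation $\lambda$ such that some location $\ell_T\in F$ is reachable in $\lambda(\mathcal{A})$. Then, assuming that the parametric zone graph $\mathcal{PZG}(\mathcal{A})$ is computed in a breadth-first manner, the algorithm $\mathit{exemplify}(\mathcal{A})$ terminates, and outputs at least one positive run (i.e. a concrete run of $\lambda'(\mathcal{A})$ for some parameter valuation $\lambda'$).
   Context: **Constraints.** Let $\mathbb{V}=\{v_1,\dots,v_H\}$ be a finite set of real-valued variables and $\mathbb{P}=\{p_1,\dots,p_M\}$ a finite set of parameters. A variable valuation is $\mu:\mathbb{V}\to\mathbb{R}$; a parameter valuation is $\lambda:\mathbb{P}\to\mathbb{Q}_{\ge 0}$; $\mu|\lambda$ is the joint valuation. A parametric linear constraint is a finite conjunction of inequalities $\sum_i\alpha_iv_i+\sum_j\beta_jp_j+d\bowtie 0$ with rational coefficients and $\bowtie\in\{<,\le,=,\ge,>\}$. $\lambda(\mathbf{C})$ is $\mathbf{C}$ with parameters replaced by their values; $\mu|\lambda\models\mathbf{C}$ means $\mu\models\lambda(\mathbf{C})$. $\mathbf{C}$ is satisfiable if some $\mu|\lambda\models\mathbf{C}$. Constraints are identified with the sets of joint valuations satisfying them. For $f:\mathbb{V}\to\mathbb{Q}$ and a real $d$, $te(\mu,f,d)(v)=\mu(v)+f(v)\,d$. For $R\subseteq\mathbb{V}$, $[\mu]_R$ sets variables in $R$ to $0$ and keeps the others; $[\mathbf{C}]_R$ is the image of $\mathbf{C}$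 under this operation. Time elapsing: $\mu'|\lambda\models \mathbf{te}(\mathbf{C},f)$ iff there are $\mu$ and $d\ge0$ with $\mu|\lambda\models\mathbf{C}$ and $\mu'=te(\mu,f,d)$. Time past $\mathbf{tp}(\mathbf{C},f)$: the same with $\mu'=te(\mu,f,-d)$. $\mathbf{C}{\downarrow_{\mathbb{P}}}$ is the projection of $\mathbf{C}$ onto the parameters. **PLMA.** A PLMA is a tuple $\mathcal{A}=(\Sigma,L,\ell_0,F,\mathbb{V},V_0,\mathbb{P},I,f,E)$: finite set of actions $\Sigma$, finite set of locations $L$, initial location $\ell_0\in L$, accepting locations $F\subseteq L$, variables $\mathbb{V}$, $V_0$ assigning to each variable an interval of initial values, parameters $\mathbb{P}$, invariants $I(\ell)$ (parametric linear constraints over $\mathbb{V}\cup\mathbb{P}$), constant rates $f(\ell,v)\in\mathbb{Q}$ (with $f(\ell)$ the map $v\mapsto f(\ell,v)$), and a finite set $E$ of edges $e=(\ell,g,a,R,\ell')$ with guard $g$ (a parametric linear constraint over $\mathbb{V}\cup\mathbb{P}$), action $a\in\Sigma$, reset set $R\subseteq\mathbb{V}$. $\lambda(\mathcal{A})$ denotes $\mathcal{A}$ with each parameter $p$ replaced by $\lambda(p)$. **Concrete semantics of $\lambda(\mathcal{A})$.** States are the pairs $(\ell,\mu)$ with $\mu\models\lambda(I(\ell))$; initial states are the states $(\ell_0,\mu)$ with $\mu(v)\in V_0(v)$ for all $v$. Discrete transition via $e=(\ell,g,a,R,\ell')$: $(\ell,\mu)\to(\ell',[\mu]_R)$ if both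 are states and $\mu\models\lambda(g)$. Delay transition of duration $d\in\mathbb{R}_{\ge0}$: $(\ell,\mu)\to(\ell,te(\mu,f(\ell),d))$ if $(\ell,te(\mu,f(\ell),d'))$ is a state for all $d'\in[0,d]$. A concrete run (also called positive run) is an alternating sequence $\sigma_0,(d_0,e_0),\sigma_1,\dots$ of states and pairs (delay, edge), starting in an initial state $\sigma_0$, where $\sigma_{i+1}$ is obtained from $\sigma_i$ by a delay $d_i$ followed by the discrete transition via $e_i$. A location is reachable if it appears in a state of some concrete run. A negative run is an alternating sequence of the same shape that is not a concrete run. **Parametric zone graph.** Symbolic states are pairs $(\ell,\mathbf{C})$ with $\mathbf{C}\subseteq I(\ell)$. The initial symbolic state is $\mathbf{s}_0=\big(\ell_0,\ \mathbf{te}(\bigwedge_i v_i\in V_0(v_i)\wedge I(\ell_0),\,f(\ell_0))\wedge I(\ell_0)\big)$. For an edge $e=(\ell,g,a,R,\ell')$, there is an arc $(\ell,\mathbf{C})\overset{e}{\Rightarrow}(\ell',\mathbf{C}')$ iff $\mathbf{C}'=\mathbf{te}\big([\mathbf{C}\wedge g]_R\wedge I(\ell'),f(\ell')\big)\wedge I(\ell')$ is satisfiable. $\mathcal{PZG}(\mathcal{A})$ is the resulting (possibly infinite) graph. A symbolic run is a path $\mathbf{s}_0,e_0,\mathbf{s}_1,\dots$ in it; its length $|\mathbf{r}|$ is its number of edges; write $\mathbf{s}_k=(\ell_k,\mathbf{C}_k)$, and $g_k,R_k$ for the guard and reset set of $e_k$. **Algorithm $\mathit{exemplify}(\mathcal{A})$.**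 (1) Explore $\mathcal{PZG}(\mathcal{A})$ from $\mathbf{s}_0$, on the fly, until a state $(\ell_T,\mathbf{C})$ with $\ell_T\in F$ is found. (2) Pick a symbolic run $\mathbf{r}$ (a shortest one) from $\mathbf{s}_0$ to $(\ell_T,\mathbf{C})$. (3) Return the set of runs $\mathit{exemplify3}(\mathcal{A},\mathbf{r})$. **Subroutines.** $\mathit{exhibitPoint}(X)$ is an effective procedure returning a valuation belonging to the given nonempty set $X$ (a polyhedron or difference of polyhedra). $\mathit{reconstructPos}(\mathcal{A},\mathbf{r},i,(\ell_i,\mu_i|\lambda))$ builds, backwards, a run prefix up to position $i$, with the parameters fixed to $\lambda$. "Cancelling time elapsing" at position $k$ from a valuation $\mu'$ means picking with $\mathit{exhibitPoint}$ a valuation in $\mathbf{tp}(\{\mu'\},f(\ell_k))\cap I(\ell_k)\cap Z_k$, where $Z_0$ is the set of valuations with $v\in V_0(v)$ for all $v$, and $Z_k=[\mathbf{C}_{k-1}\wedge g_{k-1}]_{R_{k-1}}$ for $k\ge1$. First cancel time elapsing at position $i$ from $\mu_i$, giving the last valuation $\nu_i$ of the run. Then for $k=i-1,\dots,0$: pick a discrete predecessor $\nu'_k$ with $\mathit{exhibitPoint}$ in the set of valuations of $\mathbf{C}_k\cap g_k$ that agree with $\nu_{k+1}$ on $\mathbb{V}\setminus R_k$; cancel time elapsing at position $k$ from $\nu'_k$, giving $\nu_k$; let $d_k$ be the elapsed time between $\nu_k$ and $\nu'_k$; and prepend $(\ell_k,\nu_k),(d_k,e_k)$ to the run. $\mathit{constructNeg}$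 from position $i$ with valuation $\mu_i|\lambda_i$: for each remaining edge $e_k$ of $\mathbf{r}$ ($k=i,\dots,|\mathbf{r}|-1$), append $(1,e_k)$ (duration $1$) and the valuation obtained from $\mu_i$ by adding $k-i$. **$\mathit{exemplify3}(\mathcal{A},\mathbf{r})$** returns the set of the following runs. Part 1: $\mu|\lambda:=\mathit{exhibitPoint}(\mathbf{C})$; output $\mathit{reconstructPos}(\mathcal{A},\mathbf{r},|\mathbf{r}|,(\ell_T,\mu|\lambda))$. Part 2a: search for the first $i\in\{0,\dots,|\mathbf{r}|-1\}$ with $\mathbf{C}_{i+1}{\downarrow_{\mathbb{P}}}\subsetneq\mathbf{C}_i{\downarrow_{\mathbb{P}}}$ (parametric deadlock); if there is one, pick $\lambda_i$ in the difference $\mathbf{C}_i{\downarrow_{\mathbb{P}}}\setminus\mathbf{C}_{i+1}{\downarrow_{\mathbb{P}}}$ and $\mu_i$ in $\lambda_i(\mathbf{C}_i)$, and output the concatenation of $\mathit{reconstructPos}(\mathcal{A},\mathbf{r},i,(\ell_i,\mu_i|\lambda_i))$ and $\mathit{constructNeg}$ from position $i$ with $\mu_i|\lambda_i$. Part 2b: search for the first $i\in\{0,\dots,|\mathbf{r}|-1\}$ such that, for the parameter valuation $\lambda$ of Part 1, $\mathbf{C}_i\setminus\big(\mathbf{tp}(g_i,f(\ell_i))\wedge I(\ell_i)\big)$ is nonempty (non-parametric deadlock); if there is one, pick a variable valuation $\mu_i$ in it and output the concatenation of $\mathit{reconstructPos}(\mathcal{A},\mathbf{r},i,(\ell_i,\mu_i|\lambda))$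 and $\mathit{constructNeg}$ from position $i$ with $\mu_i|\lambda$. *)

theory Defs
  imports
    "HOL-Analysis.Analysis"
    "HOL-Library.FuncSet"
    "HOL-Library.Monad_Syntax"
    "HOL-Library.While_Combinator"
begin

section \<open>Parametric linear constraints\<close>

datatype cmp = Lt | Le | Eq | Ge | Gt

fun cmp_zero :: "cmp \<Rightarrow> real \<Rightarrow> bool" where
  "cmp_zero Lt x \<longleftrightarrow> x < 0"
| "cmp_zero Le x \<longleftrightarrow> x \<le> 0"
| "cmp_zero Eq x \<longleftrightarrow> x = 0"
| "cmp_zero Ge x \<longleftrightarrow> x \<ge> 0"
| "cmp_zero Gt x \<longleftrightarrow> x > 0"

text \<open>
  The constant term is real so that the same type also describes the polyhedra met when a point
  with real coordinates is fixed. In the constraints of an automaton it is rational, see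
  \<open>plc\<close> below.
\<close>

record ('v, 'p) lin_ineq =
  var_coeff :: "'v \<Rightarrow> rat"
  par_coeff :: "'p \<Rightarrow> rat"
  const_term :: real
  comparison :: cmp

type_synonym ('v, 'p) constraint = "('v, 'p) lin_ineq list"

definition plc :: "('v, 'p) constraint \<Rightarrow> bool" where
  "plc C \<longleftrightarrow> (\<forall>c \<in> set C. const_term c \<in> \<rat>)"

type_synonym 'v var_val = "'v \<Rightarrow> real"
type_synonym 'p par_val = "'p \<Rightarrow> rat"
type_synonym ('v, 'p) joint_val = "'v var_val \<times> 'p par_val"


section \<open>Parametric linear multi-rate automata\<close>

datatype ('a, 'l, 'v, 'p) edge =
  Edge (source: 'l) (guard: "('v, 'p) constraint") (act: 'a) (resets: "'v set") (target: 'l)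

record ('a, 'l, 'v, 'p) plma =
  actions :: "'a set"
  locations :: "'l set"
  init_loc :: 'l
  accepting :: "'l set"
  vars :: "'v set"
  init_range :: "'v \<Rightarrow> real set"
  params :: "'p set"
  invariant :: "'l \<Rightarrow> ('v, 'p) constraint"
  rate :: "'l \<Rightarrow> 'v \<Rightarrow> rat"
  edges :: "('a, 'l, 'v, 'p) edge set"

definition is_plma :: "('a, 'l, 'v, 'p) plma \<Rightarrow> bool" where
  "is_plma A \<longleftrightarrow>
     finite (actions A) \<and> finite (locations A) \<and> finite (vars A) \<and> finite (params A) \<and>
     finite (edges A) \<and>
     init_loc A \<in> locations A \<and> accepting A \<subseteq> locations A \<and>
     (\<forall>v \<in> vars A. is_interval (init_range A v)) \<and>
     (\<forall>l \<in> locations A. plc (invariant A l)) \<and>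
     (\<forall>e \<in> edges A. source e \<in> locations A \<and> target e \<in> locations A \<and> act e \<in> actions A \<and>
        resets e \<subseteq> vars A \<and> plc (guard e))"

text \<open>
  The variables and the parameters form arbitrary, possibly empty, finite sets. Valuations are
  extensional functions on them, so that equality of valuations only depends on their values there.
\<close>

definition var_vals :: "('a, 'l, 'v, 'p) plma \<Rightarrow> 'v var_val set" where
  "var_vals A = (vars A \<rightarrow>\<^sub>E UNIV)"

definition par_vals :: "('a, 'l, 'v, 'p) plma \<Rightarrow> 'p par_val set" where
  "par_vals A = (params A \<rightarrow>\<^sub>E {0..})"

definition lhs :: "('a, 'l, 'v, 'p) plma \<Rightarrow> ('v, 'p) lin_ineq \<Rightarrow> ('v, 'p) joint_val \<Rightarrow> real" where
  "lhs A c w = (\<Sum>v \<in> vars A. of_rat (var_coeff c v) * fst w v)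
             + (\<Sum>p \<in> params A. of_rat (par_coeff c p) * of_rat (snd w p)) + const_term c"

text \<open>Constraints are identified with the set of joint valuations that satisfy them.\<close>

definition sol :: "('a, 'l, 'v, 'p) plma \<Rightarrow> ('v, 'p) constraint \<Rightarrow> ('v, 'p) joint_val set" where
  "sol A C = {w \<in> var_vals A \<times> par_vals A. \<forall>c \<in> set C. cmp_zero (comparison c) (lhs A c w)}"

definition elapse :: "('a, 'l, 'v, 'p) plma \<Rightarrow> 'v var_val \<Rightarrow> ('v \<Rightarrow> rat) \<Rightarrow> real \<Rightarrow> 'v var_val" where
  "elapse A \<mu> f d = (\<lambda>v \<in> vars A. \<mu> v + of_rat (f v) * d)"

definition reset :: "('a, 'l, 'v, 'p) plma \<Rightarrow> 'v set \<Rightarrow> 'v var_val \<Rightarrow> 'v var_val" where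
  "reset A R \<mu> = (\<lambda>v \<in> vars A. if v \<in> R then 0 else \<mu> v)"

definition te_set ::
    "('a, 'l, 'v, 'p) plma \<Rightarrow> ('v, 'p) joint_val set \<Rightarrow> ('v \<Rightarrow> rat) \<Rightarrow> ('v, 'p) joint_val set" where
  "te_set A C f = {(elapse A \<mu> f d, pv) | \<mu> pv d. (\<mu>, pv) \<in> C \<and> d \<ge> 0}"

definition tp_set ::
    "('a, 'l, 'v, 'p) plma \<Rightarrow> ('v, 'p) joint_val set \<Rightarrow> ('v \<Rightarrow> rat) \<Rightarrow> ('v, 'p) joint_val set" where
  "tp_set A C f = {(elapse A \<mu> f (- d), pv) | \<mu> pv d. (\<mu>, pv) \<in> C \<and> d \<ge> 0}"

definition reset_set ::
    "('a, 'l, 'v, 'p) plma \<Rightarrow> ('v, 'p) joint_val set \<Rightarrow> 'v set \<Rightarrow> ('v, 'p) joint_val set" where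
  "reset_set A C R = {(reset A R \<mu>, pv) | \<mu> pv. (\<mu>, pv) \<in> C}"

definition par_proj :: "('v, 'p) joint_val set \<Rightarrow> 'p par_val set" where
  "par_proj C = snd ` C"


section \<open>Concrete semantics\<close>

type_synonym ('l, 'v) state = "'l \<times> 'v var_val"

text \<open>The parameter valuation \<open>pv\<close> plays the role of the instantiation of \<open>A\<close>.\<close>

definition is_state :: "('a, 'l, 'v, 'p) plma \<Rightarrow> 'p par_val \<Rightarrow> ('l, 'v) state \<Rightarrow> bool" where
  "is_state A pv s \<longleftrightarrow> fst s \<in> locations A \<and> (snd s, pv) \<in> sol A (invariant A (fst s))"

definition initial_state :: "('a, 'l, 'v, 'p) plma \<Rightarrow> 'p par_val \<Rightarrow> ('l, 'v) state \<Rightarrow> bool" where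
  "initial_state A pv s \<longleftrightarrow>
     is_state A pv s \<and> fst s = init_loc A \<and> (\<forall>v \<in> vars A. snd s v \<in> init_range A v)"

definition discrete_step ::
    "('a, 'l, 'v, 'p) plma \<Rightarrow> 'p par_val \<Rightarrow> ('l, 'v) state \<Rightarrow> ('a, 'l, 'v, 'p) edge \<Rightarrow>
     ('l, 'v) state \<Rightarrow> bool" where
  "discrete_step A pv s e s' \<longleftrightarrow>
     e \<in> edges A \<and> fst s = source e \<and> s' = (target e, reset A (resets e) (snd s)) \<and>
     is_state A pv s \<and> is_state A pv s' \<and> (snd s, pv) \<in> sol A (guard e)"

definition delay_step ::
    "('a, 'l, 'v, 'p) plma \<Rightarrow> 'p par_val \<Rightarrow> ('l, 'v) state \<Rightarrow> real \<Rightarrow> ('l, 'v) state \<Rightarrow> bool" where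
  "delay_step A pv s d s' \<longleftrightarrow>
     d \<ge> 0 \<and> s' = (fst s, elapse A (snd s) (rate A (fst s)) d) \<and>
     (\<forall>d' \<in> {0..d}. is_state A pv (fst s, elapse A (snd s) (rate A (fst s)) d'))"

text \<open>
  A finite alternating sequence: the first state, and the list of the following (delay, edge) pairs,
  each one with the state it leads to.
\<close>

type_synonym ('a, 'l, 'v, 'p) run =
  "('l, 'v) state \<times> ((real \<times> ('a, 'l, 'v, 'p) edge) \<times> ('l, 'v) state) list"

primrec concrete_steps ::
    "('a, 'l, 'v, 'p) plma \<Rightarrow> 'p par_val \<Rightarrow> ('l, 'v) state \<Rightarrow>
     ((real \<times> ('a, 'l, 'v, 'p) edge) \<times> ('l, 'v) state) list \<Rightarrow> bool" where
  "concrete_steps A pv s [] \<longleftrightarrow> True"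
| "concrete_steps A pv s (x # xs) \<longleftrightarrow>
     (\<exists>u. delay_step A pv s (fst (fst x)) u \<and> discrete_step A pv u (snd (fst x)) (snd x)) \<and>
     concrete_steps A pv (snd x) xs"

definition concrete_run ::
    "('a, 'l, 'v, 'p) plma \<Rightarrow> 'p par_val \<Rightarrow> ('a, 'l, 'v, 'p) run \<Rightarrow> bool" where
  "concrete_run A pv \<rho> \<longleftrightarrow> initial_state A pv (fst \<rho>) \<and> concrete_steps A pv (fst \<rho>) (snd \<rho>)"

definition run_states :: "('a, 'l, 'v, 'p) run \<Rightarrow> ('l, 'v) state set" where
  "run_states \<rho> = insert (fst \<rho>) (snd ` set (snd \<rho>))"

definition reachable :: "('a, 'l, 'v, 'p) plma \<Rightarrow> 'p par_val \<Rightarrow> 'l \<Rightarrow> bool" where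
  "reachable A pv l \<longleftrightarrow> (\<exists>\<rho>. concrete_run A pv \<rho> \<and> l \<in> fst ` run_states \<rho>)"


section \<open>Parametric zone graph\<close>

type_synonym ('l, 'v, 'p) sym_state = "'l \<times> ('v, 'p) joint_val set"

definition init_vals :: "('a, 'l, 'v, 'p) plma \<Rightarrow> ('v, 'p) joint_val set" where
  "init_vals A = {w \<in> var_vals A \<times> par_vals A. \<forall>v \<in> vars A. fst w v \<in> init_range A v}"

definition init_sym :: "('a, 'l, 'v, 'p) plma \<Rightarrow> ('l, 'v, 'p) sym_state" where
  "init_sym A =
     (let l = init_loc A; I = sol A (invariant A l)
      in (l, te_set A (init_vals A \<inter> I) (rate A l) \<inter> I))"

definition post ::
    "('a, 'l, 'v, 'p) plma \<Rightarrow> ('l, 'v, 'p) sym_state \<Rightarrow> ('a, 'l, 'v, 'p) edge \<Rightarrow>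
     ('l, 'v, 'p) sym_state" where
  "post A s e =
     (let l' = target e; I = sol A (invariant A l')
      in (l', te_set A (reset_set A (snd s \<inter> sol A (guard e)) (resets e) \<inter> I) (rate A l') \<inter> I))"

definition arc ::
    "('a, 'l, 'v, 'p) plma \<Rightarrow> ('l, 'v, 'p) sym_state \<Rightarrow> ('a, 'l, 'v, 'p) edge \<Rightarrow>
     ('l, 'v, 'p) sym_state \<Rightarrow> bool" where
  "arc A s e s' \<longleftrightarrow> e \<in> edges A \<and> source e = fst s \<and> s' = post A s e \<and> snd s' \<noteq> {}"

text \<open>The sequence of symbolic states and the sequence of edges between them.\<close>

type_synonym ('a, 'l, 'v, 'p) sym_run =
  "('l, 'v, 'p) sym_state list \<times> ('a, 'l, 'v, 'p) edge list"

definition symbolic_run :: "('a, 'l, 'v, 'p) plma \<Rightarrow> ('a, 'l, 'v, 'p) sym_run \<Rightarrow> bool" where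
  "symbolic_run A r \<longleftrightarrow>
     length (fst r) = Suc (length (snd r)) \<and> fst r ! 0 = init_sym A \<and>
     (\<forall>k < length (snd r). arc A (fst r ! k) (snd r ! k) (fst r ! Suc k))"

definition symbolic_run_to ::
    "('a, 'l, 'v, 'p) plma \<Rightarrow> ('l, 'v, 'p) sym_state \<Rightarrow> ('a, 'l, 'v, 'p) sym_run \<Rightarrow> bool" where
  "symbolic_run_to A s r \<longleftrightarrow> symbolic_run A r \<and> last (fst r) = s"

definition shortest_symbolic_run_to ::
    "('a, 'l, 'v, 'p) plma \<Rightarrow> ('l, 'v, 'p) sym_state \<Rightarrow> ('a, 'l, 'v, 'p) sym_run \<Rightarrow> bool" where
  "shortest_symbolic_run_to A s r \<longleftrightarrow>
     symbolic_run_to A s r \<and>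
     (\<forall>r'. symbolic_run_to A s r' \<longrightarrow> length (snd r) \<le> length (snd r'))"


section \<open>Exhibiting points\<close>

definition parametric_polyhedron ::
    "('a, 'l, 'v, 'p) plma \<Rightarrow> ('v, 'p) joint_val set \<Rightarrow> bool" where
  "parametric_polyhedron A X \<longleftrightarrow> (\<exists>C. X = sol A C)"

type_synonym ('v, 'p) point_picker = "('v, 'p) joint_val set \<Rightarrow> ('v, 'p) joint_val option"

text \<open>
  A result \<open>None\<close> stands for a call that does not return. Nothing is known about a call on a set
  that is empty or that is not of the required shape. In particular it may not return.
\<close>

definition exhibits_points ::
    "('a, 'l, 'v, 'p) plma \<Rightarrow> ('v, 'p) point_picker \<Rightarrow> bool" where
  "exhibits_points A exhibit \<longleftrightarrow>
     (\<forall>X. X \<noteq> {} \<and>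
          (parametric_polyhedron A X \<or>
           (\<exists>Y Z. parametric_polyhedron A Y \<and> parametric_polyhedron A Z \<and> X = Y - Z))
          \<longrightarrow> (\<exists>w \<in> X. exhibit X = Some w))"


section \<open>Construction of the runs\<close>

text \<open>
  In this section \<open>None\<close> stands for an execution that does not terminate, which happens if some
  call to \<open>exhibit\<close> does not return.
\<close>

abbreviation loc_at :: "('a, 'l, 'v, 'p) sym_run \<Rightarrow> nat \<Rightarrow> 'l" where
  "loc_at r k \<equiv> fst (fst r ! k)"

abbreviation zone_at :: "('a, 'l, 'v, 'p) sym_run \<Rightarrow> nat \<Rightarrow> ('v, 'p) joint_val set" where
  "zone_at r k \<equiv> snd (fst r ! k)"

abbreviation edge_at :: "('a, 'l, 'v, 'p) sym_run \<Rightarrow> nat \<Rightarrow> ('a, 'l, 'v, 'p) edge" where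
  "edge_at r k \<equiv> snd r ! k"

definition entry_vals ::
    "('a, 'l, 'v, 'p) plma \<Rightarrow> ('a, 'l, 'v, 'p) sym_run \<Rightarrow> nat \<Rightarrow> ('v, 'p) joint_val set" where
  "entry_vals A r k =
     (case k of
        0 \<Rightarrow> init_vals A
      | Suc j \<Rightarrow> reset_set A (zone_at r j \<inter> sol A (guard (edge_at r j))) (resets (edge_at r j)))"

definition cancel_elapsing ::
    "('a, 'l, 'v, 'p) plma \<Rightarrow> ('v, 'p) point_picker \<Rightarrow> ('a, 'l, 'v, 'p) sym_run \<Rightarrow> nat \<Rightarrow>
     ('v, 'p) joint_val \<Rightarrow> ('v, 'p) joint_val option" where
  "cancel_elapsing A exhibit r k w =
     exhibit (tp_set A {w} (rate A (loc_at r k)) \<inter> sol A (invariant A (loc_at r k))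
              \<inter> entry_vals A r k)"

definition discrete_pred ::
    "('a, 'l, 'v, 'p) plma \<Rightarrow> ('v, 'p) point_picker \<Rightarrow> ('a, 'l, 'v, 'p) sym_run \<Rightarrow> nat \<Rightarrow>
     ('v, 'p) joint_val \<Rightarrow> ('v, 'p) joint_val option" where
  "discrete_pred A exhibit r k w =
     exhibit {w' \<in> zone_at r k \<inter> sol A (guard (edge_at r k)).
                snd w' = snd w \<and> (\<forall>v \<in> vars A - resets (edge_at r k). fst w' v = fst w v)}"

text \<open>The duration is determined as soon as some variable has a nonzero rate.\<close>

definition elapsed_time ::
    "('a, 'l, 'v, 'p) plma \<Rightarrow> ('v \<Rightarrow> rat) \<Rightarrow> 'v var_val \<Rightarrow> 'v var_val \<Rightarrow> real" where
  "elapsed_time A f \<mu> \<mu>' = (SOME d. d \<ge> 0 \<and> \<mu>' = elapse A \<mu> f d)"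

text \<open>
  \<open>reconstruct_back A exhibit r k w xs\<close> extends backwards, down to position 0, a run suffix that
  consists of the state with valuation \<open>w\<close> at position \<open>k\<close> and of the steps \<open>xs\<close> that follow.
\<close>

primrec reconstruct_back ::
    "('a, 'l, 'v, 'p) plma \<Rightarrow> ('v, 'p) point_picker \<Rightarrow> ('a, 'l, 'v, 'p) sym_run \<Rightarrow> nat \<Rightarrow>
     ('v, 'p) joint_val \<Rightarrow> ((real \<times> ('a, 'l, 'v, 'p) edge) \<times> ('l, 'v) state) list \<Rightarrow>
     ('a, 'l, 'v, 'p) run option" where
  "reconstruct_back A exhibit r 0 w xs = Some ((loc_at r 0, fst w), xs)"
| "reconstruct_back A exhibit r (Suc k) w xs =
     do {
       w' \<leftarrow> discrete_pred A exhibit r k w;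
       u \<leftarrow> cancel_elapsing A exhibit r k w';
       let d = elapsed_time A (rate A (loc_at r k)) (fst u) (fst w');
       reconstruct_back A exhibit r k u (((d, edge_at r k), (loc_at r (Suc k), fst w)) # xs)
     }"

definition reconstruct_pos ::
    "('a, 'l, 'v, 'p) plma \<Rightarrow> ('v, 'p) point_picker \<Rightarrow> ('a, 'l, 'v, 'p) sym_run \<Rightarrow> nat \<Rightarrow>
     ('v, 'p) joint_val \<Rightarrow> ('a, 'l, 'v, 'p) run option" where
  "reconstruct_pos A exhibit r i w =
     do {
       u \<leftarrow> cancel_elapsing A exhibit r i w;
       reconstruct_back A exhibit r i u []
     }"

definition construct_neg ::
    "('a, 'l, 'v, 'p) plma \<Rightarrow> ('a, 'l, 'v, 'p) sym_run \<Rightarrow> nat \<Rightarrow> 'v var_val \<Rightarrow>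
     ((real \<times> ('a, 'l, 'v, 'p) edge) \<times> ('l, 'v) state) list" where
  "construct_neg A r i \<mu> =
     map (\<lambda>k. ((1, edge_at r k), (loc_at r (Suc k), \<lambda>v \<in> vars A. \<mu> v + real (k - i))))
       [i..<length (snd r)]"

definition pos_then_neg ::
    "('a, 'l, 'v, 'p) plma \<Rightarrow> ('v, 'p) point_picker \<Rightarrow> ('a, 'l, 'v, 'p) sym_run \<Rightarrow> nat \<Rightarrow>
     ('v, 'p) joint_val \<Rightarrow> ('a, 'l, 'v, 'p) run option" where
  "pos_then_neg A exhibit r i w =
     do {
       \<rho> \<leftarrow> reconstruct_pos A exhibit r i w;
       Some (fst \<rho>, snd \<rho> @ construct_neg A r i (fst w))
     }"

text \<open>
  Sets of parameter valuations are handed to \<open>exhibit\<close> as cylinders of joint valuations.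
\<close>

definition parametric_deadlock_runs ::
    "('a, 'l, 'v, 'p) plma \<Rightarrow> ('v, 'p) point_picker \<Rightarrow> ('a, 'l, 'v, 'p) sym_run \<Rightarrow>
     ('a, 'l, 'v, 'p) run set option" where
  "parametric_deadlock_runs A exhibit r =
     (let found = (\<lambda>i. i < length (snd r) \<and> par_proj (zone_at r (Suc i)) \<subset> par_proj (zone_at r i))
      in if \<exists>i. found i then
           let i = (LEAST i. found i) in
           do {
             u \<leftarrow> exhibit (var_vals A \<times> (par_proj (zone_at r i) - par_proj (zone_at r (Suc i))));
             w \<leftarrow> exhibit {w \<in> zone_at r i. snd w = snd u};
             \<rho> \<leftarrow> pos_then_neg A exhibit r i w;
             Some {\<rho>}
           }
         else Some {})"

definition nonparametric_deadlock_runs ::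
    "('a, 'l, 'v, 'p) plma \<Rightarrow> ('v, 'p) point_picker \<Rightarrow> ('a, 'l, 'v, 'p) sym_run \<Rightarrow> 'p par_val \<Rightarrow>
     ('a, 'l, 'v, 'p) run set option" where
  "nonparametric_deadlock_runs A exhibit r pv =
     (let blocked = (\<lambda>i. {w \<in> zone_at r i. snd w = pv} -
            (tp_set A (sol A (guard (edge_at r i))) (rate A (loc_at r i))
             \<inter> sol A (invariant A (loc_at r i))));
          found = (\<lambda>i. i < length (snd r) \<and> blocked i \<noteq> {})
      in if \<exists>i. found i then
           let i = (LEAST i. found i) in
           do {
             w \<leftarrow> exhibit (blocked i);
             \<rho> \<leftarrow> pos_then_neg A exhibit r i w;
             Some {\<rho>}
           }
         else Some {})"

definition exemplify3 ::
    "('a, 'l, 'v, 'p) plma \<Rightarrow> ('v, 'p) point_picker \<Rightarrow> ('a, 'l, 'v, 'p) sym_run \<Rightarrow>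
     ('a, 'l, 'v, 'p) run set option" where
  "exemplify3 A exhibit r =
     do {
       w \<leftarrow> exhibit (zone_at r (length (snd r)));
       \<rho> \<leftarrow> reconstruct_pos A exhibit r (length (snd r)) w;
       N1 \<leftarrow> parametric_deadlock_runs A exhibit r;
       N2 \<leftarrow> nonparametric_deadlock_runs A exhibit r (snd w);
       Some ({\<rho>} \<union> N1 \<union> N2)
     }"


section \<open>Breadth-first exploration and the main algorithm\<close>

text \<open>
  A configuration is the set of the symbolic states discovered so far, and the queue of those that
  remain to be processed. The list \<open>es\<close> enumerates the edges of the automaton, and thereby fixes the
  order in which the successors are generated.
\<close>

definition bfs_continue ::
    "('a, 'l, 'v, 'p) plma \<Rightarrow>
     ('l, 'v, 'p) sym_state set \<times> ('l, 'v, 'p) sym_state list \<Rightarrow> bool" where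
  "bfs_continue A c \<longleftrightarrow> snd c \<noteq> [] \<and> fst (hd (snd c)) \<notin> accepting A"

definition bfs_step ::
    "('a, 'l, 'v, 'p) plma \<Rightarrow> ('a, 'l, 'v, 'p) edge list \<Rightarrow>
     ('l, 'v, 'p) sym_state set \<times> ('l, 'v, 'p) sym_state list \<Rightarrow>
     ('l, 'v, 'p) sym_state set \<times> ('l, 'v, 'p) sym_state list" where
  "bfs_step A es c =
     (let s = hd (snd c);
          succs = map (post A s) (filter (\<lambda>e. arc A s e (post A s e)) es);
          new = remdups (filter (\<lambda>s'. s' \<notin> fst c) succs)
      in (fst c \<union> set new, tl (snd c) @ new))"

definition bfs ::
    "('a, 'l, 'v, 'p) plma \<Rightarrow> ('a, 'l, 'v, 'p) edge list \<Rightarrow>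
     (('l, 'v, 'p) sym_state set \<times> ('l, 'v, 'p) sym_state list) option" where
  "bfs A es = while_option (bfs_continue A) (bfs_step A es) ({init_sym A}, [init_sym A])"

text \<open>
  \<open>pick\<close> selects a symbolic run to the state that was found. The result is \<open>None\<close> iff the execution
  does not terminate: \<open>while_option\<close> yields \<open>None\<close> exactly for a loop that runs forever. If the
  exploration ends without an accepting state, no run is output.
\<close>

definition exemplify ::
    "('a, 'l, 'v, 'p) plma \<Rightarrow> ('a, 'l, 'v, 'p) edge list \<Rightarrow>
     (('l, 'v, 'p) sym_state \<Rightarrow> ('a, 'l, 'v, 'p) sym_run) \<Rightarrow> ('v, 'p) point_picker \<Rightarrow>
     ('a, 'l, 'v, 'p) run set option" where
  "exemplify A es pick exhibit =
     do {
       c \<leftarrow> bfs A es;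
       case snd c of
         [] \<Rightarrow> Some {}
       | s # _ \<Rightarrow> exemplify3 A exhibit (pick s)
     }"

end

theory Submission
  imports Defs
begin

text \<open>
  Over finitely many real variables and rational parameters, Fourier-Motzkin elimination of a real
  unknown only multiplies constraints by rational coefficients. Hence sets defined by constraints are
  closed under time elapsing, time past, resets and projection to the parameters, and every set on
  which a point is requested is a polyhedron or a difference of two polyhedra. The sets requested
  during the backward reconstruction are nonempty because a zone consists of the points reached by
  an edge and a delay from the preceding zone. Invariants hold all along a delay because they are convex.
  Breadth-first exploration of the finitely branching zone graph reaches an accepting state because a
  concrete run to an accepting location lifts to a path of symbolic states.
\<close>

section \<open>Parametric polyhedra\<close>

definition joint_vals :: "('a, 'l, 'v, 'p) plma \<Rightarrow> ('v, 'p) joint_val set" where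
  "joint_vals A = var_vals A \<times> par_vals A"

definition affine_form :: "('a, 'l, 'v, 'p) plma \<Rightarrow> (('v, 'p) joint_val \<Rightarrow> real) \<Rightarrow> bool" where
  "affine_form A F \<longleftrightarrow> (\<exists>c. F = lhs A c)"

lemma affine_form_lhs: "affine_form A (lhs A c)"
  by (auto simp: affine_form_def)

lemma affine_form_combination:
  assumes "affine_form A F" "affine_form A G"
  shows "affine_form A (\<lambda>w. of_rat a * F w + of_rat b * G w)"
proof -
  obtain c c' where c: "F = lhs A c" "G = lhs A c'"
    using assms by (auto simp: affine_form_def)
  let ?c = "\<lparr>var_coeff = \<lambda>v. a * var_coeff c v + b * var_coeff c' v,
             par_coeff = \<lambda>p. a * par_coeff c p + b * par_coeff c' p,
             const_term = of_rat a * const_term c + of_rat b * const_term c',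
             comparison = Le\<rparr>"
  have "(\<lambda>w. of_rat a * F w + of_rat b * G w) = lhs A ?c"
    by (rule ext)
       (simp add: c lhs_def of_rat_add of_rat_mult algebra_simps sum.distrib sum_distrib_left)
  then show ?thesis
    by (auto simp: affine_form_def)
qed

lemma affine_form_const: "affine_form A (\<lambda>_. r)"
proof -
  have "(\<lambda>_. r) = lhs A \<lparr>var_coeff = \<lambda>_. 0, par_coeff = \<lambda>_. 0, const_term = r, comparison = Le\<rparr>"
    by (rule ext) (simp add: lhs_def)
  then show ?thesis
    by (auto simp: affine_form_def)
qed

lemma affine_form_var:
  assumes "finite (vars A)" "v \<in> vars A"
  shows "affine_form A (\<lambda>w. fst w v - r)"
proof -
  have "(\<lambda>w. fst w v - r) =
      lhs A \<lparr>var_coeff = \<lambda>u. if u = v then 1 else 0, par_coeff = \<lambda>_. 0, const_term = - r,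
             comparison = Le\<rparr>"
    using assms
    by (intro ext) (simp add: lhs_def if_distrib[of of_rat] if_distrib[of "\<lambda>x. x * _"] cong: if_cong)
  then show ?thesis
    by (auto simp: affine_form_def)
qed

lemma affine_form_par:
  assumes "finite (params A)" "p \<in> params A"
  shows "affine_form A (\<lambda>w. of_rat (snd w p) - r)"
proof -
  have "(\<lambda>w. of_rat (snd w p) - r) =
      lhs A \<lparr>var_coeff = \<lambda>_. 0, par_coeff = \<lambda>q. if q = p then 1 else 0, const_term = - r,
             comparison = Le\<rparr>"
    using assms
    by (intro ext) (simp add: lhs_def if_distrib[of of_rat] if_distrib[of "\<lambda>x. x * _"] cong: if_cong)
  then show ?thesis
    by (auto simp: affine_form_def)
qed

section \<open>Polyhedra: finite conjunctions and basic conditions\<close>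

lemma sol_subset: "sol A C \<subseteq> joint_vals A"
  by (auto simp: sol_def joint_vals_def)

lemma polyhedron_sol: "parametric_polyhedron A (sol A C)"
  by (auto simp: parametric_polyhedron_def)

lemma polyhedron_subset: "parametric_polyhedron A X \<Longrightarrow> X \<subseteq> joint_vals A"
  using sol_subset by (auto simp: parametric_polyhedron_def)

lemma polyhedron_joint_vals: "parametric_polyhedron A (joint_vals A)"
  by (auto simp: parametric_polyhedron_def sol_def joint_vals_def intro!: exI[of _ "[]"])

lemma polyhedron_Int:
  assumes "parametric_polyhedron A X" "parametric_polyhedron A Y"
  shows "parametric_polyhedron A (X \<inter> Y)"
proof -
  obtain C C' where "X = sol A C" "Y = sol A C'"
    using assms by (auto simp: parametric_polyhedron_def)
  then have "X \<inter> Y = sol A (C @ C')"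
    by (auto simp: sol_def)
  then show ?thesis
    by (auto simp: parametric_polyhedron_def)
qed

lemma polyhedron_conj:
  assumes "parametric_polyhedron A {w \<in> joint_vals A. P w}"
    and "parametric_polyhedron A {w \<in> joint_vals A. Q w}"
  shows "parametric_polyhedron A {w \<in> joint_vals A. P w \<and> Q w}"
proof -
  have "{w \<in> joint_vals A. P w \<and> Q w} = {w \<in> joint_vals A. P w} \<inter> {w \<in> joint_vals A. Q w}"
    by auto
  then show ?thesis
    using polyhedron_Int[OF assms] by simp
qed

lemma polyhedron_Ball:
  assumes "finite I" "\<And>i. i \<in> I \<Longrightarrow> parametric_polyhedron A {w \<in> joint_vals A. P i w}"
  shows "parametric_polyhedron A {w \<in> joint_vals A. \<forall>i \<in> I. P i w}"
  using assms
proof (induction I)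
  case empty
  then show ?case
    by (simp add: polyhedron_joint_vals)
next
  case (insert i I)
  then show ?case
    using polyhedron_conj[of A "P i" "\<lambda>w. \<forall>i \<in> I. P i w"] by simp
qed

lemma polyhedron_cmp_zero:
  assumes "affine_form A F"
  shows "parametric_polyhedron A {w \<in> joint_vals A. cmp_zero k (F w)}"
proof -
  obtain c where "F = lhs A c"
    using assms by (auto simp: affine_form_def)
  then have "{w \<in> joint_vals A. cmp_zero k (F w)} = sol A [c\<lparr>comparison := k\<rparr>]"
    by (auto simp: sol_def joint_vals_def lhs_def)
  then show ?thesis
    by (auto simp: parametric_polyhedron_def)
qed

lemma polyhedron_const: "parametric_polyhedron A {w \<in> joint_vals A. b}"
  \<comment> \<open>The constant forms -1 and 1 compared by \<open>Lt\<close> encode truth and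
    falsity.\<close>
  using polyhedron_cmp_zero[OF affine_form_const, of A Lt "if b then -1 else 1"]
  by (cases b) auto

lemma polyhedron_imp_const:
  assumes "b \<Longrightarrow> parametric_polyhedron A {w \<in> joint_vals A. P w}"
  shows "parametric_polyhedron A {w \<in> joint_vals A. b \<longrightarrow> P w}"
  using assms polyhedron_const[of A True] by (cases b) auto

lemma polyhedron_var_cmp:
  assumes "finite (vars A)" "v \<in> vars A"
  shows "parametric_polyhedron A {w \<in> joint_vals A. cmp_zero k (fst w v - r)}"
  using assms by (intro polyhedron_cmp_zero affine_form_var)

lemma polyhedron_vars_eq:
  assumes "finite (vars A)" "V \<subseteq> vars A"
  shows "parametric_polyhedron A {w \<in> joint_vals A. \<forall>v \<in> V. fst w v = \<mu> v}"
  using assms polyhedron_var_cmp[of A _ Eq]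
  by (intro polyhedron_Ball) (auto intro: finite_subset)

lemma par_vals_eq_iff:
  assumes "q \<in> par_vals A" "q' \<in> par_vals A"
  shows "q = q' \<longleftrightarrow> (\<forall>p \<in> params A. q p = q' p)"
  using assms by (auto simp: par_vals_def intro: PiE_ext)

lemma polyhedron_snd_eq:
  assumes "finite (params A)"
  shows "parametric_polyhedron A {w \<in> joint_vals A. snd w = q}"
proof (cases "q \<in> par_vals A")
  case True
  then have "{w \<in> joint_vals A. snd w = q} =
      {w \<in> joint_vals A. \<forall>p \<in> params A. cmp_zero Eq (of_rat (snd w p) - of_rat (q p))}"
    by (auto simp: joint_vals_def par_vals_eq_iff)
  then show ?thesis
    using assms by (simp only:) (intro polyhedron_Ball polyhedron_cmp_zero affine_form_par)
next
  case False
  \<comment> \<open>No joint valuation has an inadmissible \<open>q\<close>: the set is empty, which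
    is again a polyhedron.\<close>
  then have "{w \<in> joint_vals A. snd w = q} = {w \<in> joint_vals A. False}"
    by (auto simp: joint_vals_def)
  then show ?thesis
    using polyhedron_const[of A False] by (simp only:)
qed

lemma polyhedron_restrict:
  assumes "parametric_polyhedron A X" "parametric_polyhedron A {w \<in> joint_vals A. P w}"
  shows "parametric_polyhedron A {w \<in> X. P w}"
proof -
  have "{w \<in> X. P w} = X \<inter> {w \<in> joint_vals A. P w}"
    using polyhedron_subset[OF assms(1)] by auto
  then show ?thesis
    using polyhedron_Int[OF assms] by simp
qed

lemma polyhedron_singleton:
  assumes "finite (vars A)" "finite (params A)" "w \<in> joint_vals A"
  shows "parametric_polyhedron A {w}"
proof -
  have "{w} = {w' \<in> joint_vals A. (\<forall>v \<in> vars A. fst w' v = fst w v) \<and> snd w' = snd w}"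
    using assms(3) PiE_ext[of _ "vars A" "\<lambda>_. UNIV" "fst w"]
    by (auto simp: joint_vals_def var_vals_def prod_eq_iff)
  also have "parametric_polyhedron A \<dots>"
    using assms by (intro polyhedron_conj[OF polyhedron_vars_eq polyhedron_snd_eq]) auto
  finally show ?thesis .
qed

lemma real_interval_cases:
  fixes S :: "real set"
  assumes "is_interval S"
  obtains "S = {}" | "S = UNIV" | a where "S = {..<a}" | a where "S = {..a}" | a where "S = {a<..}"
  | a where "S = {a..}" | a b where "S = {a<..<b}" | a b where "S = {a<..b}" | a b where "S = {a..<b}"
  | a b where "S = {a..b}"
  using is_real_interval[OF assms] by blast

text \<open>Each shape of a real interval needs at most two comparisons. The endpoints may be
  irrational, which the real constant term of a constraint accommodates.\<close>

lemma polyhedron_interval: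
  assumes "finite (vars A)" "v \<in> vars A" "is_interval S"
  shows "parametric_polyhedron A {w \<in> joint_vals A. fst w v \<in> S}"
proof -
  note cmp = polyhedron_var_cmp[OF assms(1,2)]
  have lt: "parametric_polyhedron A {w \<in> joint_vals A. fst w v < r}" for r
    using cmp[of Lt r] by simp
  have le: "parametric_polyhedron A {w \<in> joint_vals A. fst w v \<le> r}" for r
    using cmp[of Le r] by simp
  have gt: "parametric_polyhedron A {w \<in> joint_vals A. r < fst w v}" for r
    using cmp[of Gt r] by simp
  have ge: "parametric_polyhedron A {w \<in> joint_vals A. r \<le> fst w v}" for r
    using cmp[of Ge r] by simp
  show ?thesis
    using assms(3)
    by (cases rule: real_interval_cases)
       (use polyhedron_const[of A False] polyhedron_joint_vals[of A] in
         \<open>simp_all add: lt le gt ge polyhedron_conj\<close>)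
qed

lemma polyhedron_init_vals:
  assumes "is_plma A"
  shows "parametric_polyhedron A (init_vals A)"
proof -
  have "init_vals A = {w \<in> joint_vals A. \<forall>v \<in> vars A. fst w v \<in> init_range A v}"
    by (simp add: init_vals_def joint_vals_def)
  then show ?thesis
    using assms by (simp add: is_plma_def polyhedron_Ball polyhedron_interval)
qed


section \<open>Fourier-Motzkin elimination\<close>

text \<open>One flag covers strict and weak inequalities, so that elimination needs no case
  distinction: a sum is strict as soon as one summand is.\<close>

definition neg_rel :: "bool \<Rightarrow> real \<Rightarrow> bool" where
  "neg_rel strict x \<longleftrightarrow> (if strict then x < 0 else x \<le> 0)"

lemma neg_rel_mult_pos: "0 < c \<Longrightarrow> neg_rel s (c * x) \<longleftrightarrow> neg_rel s x"
  by (auto simp: neg_rel_def mult_less_0_iff mult_le_0_iff)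

lemma neg_rel_add: "neg_rel s x \<Longrightarrow> neg_rel t y \<Longrightarrow> neg_rel (s \<or> t) (x + y)"
  by (auto simp: neg_rel_def split: if_splits)

text \<open>Finitely many bounds attain a largest lower and a least upper one, and the midpoint of
  these two satisfies all of them. If one family is empty, a number beyond all bounds of the other
  will do.\<close>

lemma bounds_compatible:
  fixes l u :: "'i \<Rightarrow> real"
  assumes "finite L" "finite U"
    and compat: "\<And>i j. i \<in> L \<Longrightarrow> j \<in> U \<Longrightarrow> neg_rel (s i \<or> s j) (l i - u j)"
  shows "\<exists>d. (\<forall>i \<in> L. neg_rel (s i) (l i - d)) \<and> (\<forall>j \<in> U. neg_rel (s j) (d - u j))"
proof (cases "L = {} \<or> U = {}")
  case True
  show ?thesis
  proof (cases "U = {}")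
    case True
    \<comment> \<open>Inserting 0 keeps the maximum defined when \<open>L\<close> is empty as well;
      adding 1 makes the bound strict.\<close>
    have "l i < Max (insert 0 (l ` L)) + 1" if "i \<in> L" for i
    proof -
      have "l i \<le> Max (insert 0 (l ` L))"
        using that assms(1) by (intro Max_ge) auto
      then show ?thesis by linarith
    qed
    then show ?thesis
      using True by (intro exI[of _ "Max (insert 0 (l ` L)) + 1"]) (force simp: neg_rel_def)
  next
    case False
    then have "L = {}" using \<open>L = {} \<or> U = {}\<close> by simp
    moreover have "Min (insert 0 (u ` U)) - 1 < u j" if "j \<in> U" for j
    proof -
      have "Min (insert 0 (u ` U)) \<le> u j"
        using that assms(2) by (intro Min_le) auto
      then show ?thesis by linarith
    qed
    ultimately show ?thesis
      by (intro exI[of _ "Min (insert 0 (u ` U)) - 1"]) (force simp: neg_rel_def)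
  qed
next
  case False
  define M where "M = Max (l ` L)"
  define m where "m = Min (u ` U)"
  obtain i0 where i0: "i0 \<in> L" "M = l i0"
    using False assms(1) Max_in[of "l ` L"] unfolding M_def by blast
  obtain j0 where j0: "j0 \<in> U" "m = u j0"
    using False assms(2) Min_in[of "u ` U"] unfolding m_def by blast
  have lM: "l i \<le> M" if "i \<in> L" for i
    using that assms(1) by (simp add: M_def)
  have mu: "m \<le> u j" if "j \<in> U" for j
    using that assms(2) by (simp add: m_def)
  have "M \<le> m"
    using compat[OF i0(1) j0(1)] i0 j0 by (auto simp: neg_rel_def split: if_splits)
  show ?thesis
  \<comment> \<open>If \<open>M = m\<close>, the midpoint is this common value, and compatibility
    with \<open>j0\<close> or \<open>i0\<close> keeps every strict bound away from it.\<close>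
  proof (intro exI[of _ "(M + m) / 2"] conjI ballI)
    fix i assume i: "i \<in> L"
    then show "neg_rel (s i) (l i - (M + m) / 2)"
      using lM[OF i] compat[OF i j0(1)] j0 \<open>M \<le> m\<close>
      by (auto simp: neg_rel_def field_simps split: if_splits)
  next
    fix j assume j: "j \<in> U"
    then show "neg_rel (s j) ((M + m) / 2 - u j)"
      using mu[OF j] compat[OF i0(1) j] i0 \<open>M \<le> m\<close>
      by (auto simp: neg_rel_def field_simps split: if_splits)
  qed
qed

text \<open>A negative coefficient yields a lower bound \<open>- b i / a i\<close> on
  \<open>d\<close>, a positive one an upper bound. Comparing them after cross multiplication, rather
  than division, leaves linear combinations of the \<open>b i\<close> whose factors are the given
  coefficients.\<close>

lemma fourier_motzkin:
  fixes a b :: "'i \<Rightarrow> real"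
  assumes "finite I"
  shows "(\<exists>d. \<forall>i \<in> I. neg_rel (s i) (a i * d + b i)) \<longleftrightarrow>
    (\<forall>i \<in> I. a i = 0 \<longrightarrow> neg_rel (s i) (b i)) \<and>
    (\<forall>i \<in> I. \<forall>j \<in> I. a i < 0 \<and> 0 < a j \<longrightarrow> neg_rel (s i \<or> s j) (a j * b i + (- a i) * b j))"
    (is "?lhs \<longleftrightarrow> ?rhs")
proof
  assume ?lhs
  then obtain d where d: "\<And>i. i \<in> I \<Longrightarrow> neg_rel (s i) (a i * d + b i)" by auto
  have "neg_rel (s i \<or> s j) (a j * b i + (- a i) * b j)"
    if "i \<in> I" "j \<in> I" "a i < 0" "0 < a j" for i j
  proof -
    have "neg_rel (s i) (a j * (a i * d + b i))" "neg_rel (s j) ((- a i) * (a j * d + b j))"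
      using that d by (simp_all only: neg_rel_mult_pos neg_0_less_iff_less)
    from neg_rel_add[OF this] show ?thesis
      by (simp add: algebra_simps)
  qed
  then show ?rhs
    using d by force
next
  assume ?rhs
  define L where "L = {i \<in> I. a i < 0}"
  define U where "U = {i \<in> I. 0 < a i}"
  have "neg_rel (s i \<or> s j) (- b i / a i - (- b j / a j))" if "i \<in> L" "j \<in> U" for i j
  proof -
    have a: "a i < 0" "0 < a j" and "neg_rel (s i \<or> s j) (a j * b i + (- a i) * b j)"
      using that \<open>?rhs\<close> by (auto simp: L_def U_def)
    \<comment> \<open>The combined inequality is the comparison of the two bounds, scaled by the
      positive number \<open>- a i * a j\<close>.\<close>
    moreover have "a j * b i + (- a i) * b j = (- a i * a j) * (- b i / a i - (- b j / a j))"
      using a by (simp add: field_simps)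
    ultimately show ?thesis
      using neg_rel_mult_pos[of "- a i * a j"] by (simp add: mult_neg_pos)
  qed
  then obtain d where d: "\<And>i. i \<in> L \<Longrightarrow> neg_rel (s i) (- b i / a i - d)"
      "\<And>j. j \<in> U \<Longrightarrow> neg_rel (s j) (d - (- b j / a j))"
    using bounds_compatible[of L U s "\<lambda>i. - b i / a i" "\<lambda>i. - b i / a i"] assms
    by (auto simp: L_def U_def)
  have "neg_rel (s i) (a i * d + b i)" if i: "i \<in> I" for i
  proof -
    consider "a i < 0" | "a i = 0" | "0 < a i" by linarith
    then show ?thesis
    proof cases
      case 1
      then have "a i * d + b i = (- a i) * (- b i / a i - d)"
        by (simp add: field_simps)
      with 1 i d(1)[of i] show ?thesis
        using neg_rel_mult_pos[of "- a i"] by (simp add: L_def)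
    next
      case 2
      then show ?thesis using \<open>?rhs\<close> i by simp
    next
      case 3
      then have "a i * d + b i = a i * (d - (- b i / a i))"
        by (simp add: field_simps)
      with 3 i d(2)[of i] show ?thesis
        using neg_rel_mult_pos[of "a i"] by (simp add: U_def)
    qed
  qed
  then show ?lhs by auto
qed

section \<open>Time elapsing as elimination of the duration\<close>

fun neg_forms :: "cmp \<Rightarrow> (rat \<times> bool) set" where
  "neg_forms Lt = {(1, True)}"
| "neg_forms Le = {(1, False)}"
| "neg_forms Eq = {(1, False), (-1, False)}"
| "neg_forms Ge = {(-1, False)}"
| "neg_forms Gt = {(-1, True)}"

lemma finite_neg_forms: "finite (neg_forms k)"
  by (cases k) auto

text \<open>Reduces the five comparisons to the form that elimination handles; an equation becomes
  two opposite weak inequalities. The sign is rational so that it may scale an affine form.\<close>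

lemma cmp_zero_neg_forms:
  "cmp_zero k x \<longleftrightarrow> (\<forall>(\<sigma>, s) \<in> neg_forms k. neg_rel s (of_rat \<sigma> * x))"
  by (cases k) (auto simp: neg_rel_def of_rat_minus)

text \<open>The derivative of the left-hand side along the flow \<open>f\<close>. It is rational,
  which keeps elimination of the real duration within rational coefficients.\<close>

definition slope :: "('a, 'l, 'v, 'p) plma \<Rightarrow> ('v, 'p) lin_ineq \<Rightarrow> ('v \<Rightarrow> rat) \<Rightarrow> rat" where
  "slope A c f = (\<Sum>v \<in> vars A. var_coeff c v * f v)"

lemma lhs_elapse: "lhs A c (elapse A \<mu> f d, q) = lhs A c (\<mu>, q) + of_rat (slope A c f) * d"
  by (simp add: lhs_def slope_def elapse_def algebra_simps sum.distrib of_rat_sum of_rat_mult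
      sum_distrib_left sum_distrib_right cong: sum.cong)

lemma elapse_in_var_vals: "elapse A \<mu> f d \<in> var_vals A"
  by (auto simp: elapse_def var_vals_def)

lemma elapse_0: "\<mu> \<in> var_vals A \<Longrightarrow> elapse A \<mu> f 0 = \<mu>"
  by (auto simp: elapse_def var_vals_def intro!: PiE_ext[of _ "vars A" "\<lambda>_. UNIV"])

lemma elapse_elapse: "elapse A (elapse A \<mu> f d) f d' = elapse A \<mu> f (d + d')"
  by (auto simp: elapse_def algebra_simps)

lemma elapse_minus: "elapse A \<mu> (\<lambda>v. - f v) d = elapse A \<mu> f (- d)"
  by (auto simp: elapse_def of_rat_minus)

lemma elapse_back: "\<mu> \<in> var_vals A \<Longrightarrow> elapse A (elapse A \<mu> f d) f (- d) = \<mu>"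
  "\<mu> \<in> var_vals A \<Longrightarrow> elapse A (elapse A \<mu> f (- d)) f d = \<mu>"
  by (simp_all add: elapse_elapse elapse_0)

text \<open>A flow is invertible on extensional valuations, so the image can be written as a
  preimage in which the duration is the only unknown under the quantifier.\<close>

lemma tp_set_eq:
  assumes "S \<subseteq> joint_vals A"
  shows "tp_set A S f = {w \<in> joint_vals A. \<exists>d\<ge>0. (elapse A (fst w) f d, snd w) \<in> S}"
proof (intro equalityI subsetI)
  fix w assume "w \<in> tp_set A S f"
  then show "w \<in> {w \<in> joint_vals A. \<exists>d\<ge>0. (elapse A (fst w) f d, snd w) \<in> S}"
    using assms by (force simp: tp_set_def joint_vals_def elapse_in_var_vals elapse_back)
next
  fix w assume "w \<in> {w \<in> joint_vals A. \<exists>d\<ge>0. (elapse A (fst w) f d, snd w) \<in> S}"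
  then obtain d where d: "d \<ge> 0" "(elapse A (fst w) f d, snd w) \<in> S" "fst w \<in> var_vals A"
    by (auto simp: joint_vals_def)
  then have "w = (elapse A (elapse A (fst w) f d) f (- d), snd w)"
    by (simp add: elapse_back)
  then show "w \<in> tp_set A S f"
    using d unfolding tp_set_def by blast
qed

text \<open>Reversing all rates exchanges future and past, so one direction suffices.\<close>

lemma te_set_eq_tp_set: "te_set A S f = tp_set A S (\<lambda>v. - f v)"
  by (simp add: te_set_def tp_set_def elapse_minus)

text \<open>Along the flow each constraint is affine in the duration with a rational slope.
  Eliminating the duration therefore leaves finitely many conditions on affine forms.\<close>

lemma polyhedron_tp_set:
  assumes "parametric_polyhedron A S"
  shows "parametric_polyhedron A (tp_set A S f)"
proof -
  obtain C where C: "S = sol A C"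
    using assms by (auto simp: parametric_polyhedron_def)
  \<comment> \<open>An index is a triple of a strictness flag, the coefficient of the duration and an affine form;
    the first one stands for the condition that the duration is nonnegative.\<close>
  define I where "I = insert (False, -1, \<lambda>_. 0)
    (\<Union>c \<in> set C. (\<lambda>(\<sigma>, s). (s, \<sigma> * slope A c f, \<lambda>w. of_rat \<sigma> * lhs A c w)) ` neg_forms (comparison c))"
  have fin: "finite I"
    by (simp add: I_def finite_neg_forms)
  have affine: "affine_form A (snd (snd i))" if "i \<in> I" for i
    using that affine_form_combination[OF affine_form_lhs affine_form_const, of A _ _ 0 0]
    by (auto simp: I_def affine_form_const)
  have "(\<exists>d\<ge>0. (elapse A (fst w) f d, snd w) \<in> S) \<longleftrightarrow>
      (\<exists>d. \<forall>i \<in> I. neg_rel (fst i) (of_rat (fst (snd i)) * d + snd (snd i) w))"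
    if w: "w \<in> joint_vals A" for w
  proof -
    have "0 \<le> d \<and> (elapse A (fst w) f d, snd w) \<in> S \<longleftrightarrow>
      (\<forall>i \<in> I. neg_rel (fst i) (of_rat (fst (snd i)) * d + snd (snd i) w))" for d
      using w
      by (auto simp: C sol_def I_def joint_vals_def elapse_in_var_vals cmp_zero_neg_forms lhs_elapse
          of_rat_mult of_rat_minus algebra_simps neg_rel_def[of False "- d"] split: prod.splits)
    then show ?thesis by auto
  qed
  then have eq: "tp_set A S f = {w \<in> joint_vals A.
      \<exists>d. \<forall>i \<in> I. neg_rel (fst i) (of_rat (fst (snd i)) * d + snd (snd i) w)}"
    unfolding tp_set_eq[OF polyhedron_subset[OF assms]] by (intro Collect_cong conj_cong refl)
  have half: "parametric_polyhedron A {w \<in> joint_vals A. neg_rel s (F w)}" if "affine_form A F" for s F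
    using polyhedron_cmp_zero[OF that, of Lt] polyhedron_cmp_zero[OF that, of Le]
    by (cases s) (simp_all add: neg_rel_def)
  have comb: "affine_form A (\<lambda>w. of_rat a * snd (snd i) w + - of_rat b * snd (snd j) w)"
    if "i \<in> I" "j \<in> I" for i j a b
    using affine_form_combination[OF affine[OF that(1)] affine[OF that(2)], of a "- b"]
    by (simp add: of_rat_minus)
  show ?thesis
    unfolding eq fourier_motzkin[OF fin]
    by (intro polyhedron_conj polyhedron_Ball[OF fin] polyhedron_imp_const half affine comb)
qed

lemma polyhedron_te_set:
  "parametric_polyhedron A S \<Longrightarrow> parametric_polyhedron A (te_set A S f)"
  by (simp add: te_set_eq_tp_set polyhedron_tp_set)

section \<open>Resets and parameter projections through cylinders\<close>

definition cylinder ::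
    "('a, 'l, 'v, 'p) plma \<Rightarrow> 'v set \<Rightarrow> ('v, 'p) joint_val set \<Rightarrow> ('v, 'p) joint_val set" where
  "cylinder A R S = {w \<in> joint_vals A. \<exists>\<mu>. (\<forall>v \<in> vars A - R. \<mu> v = fst w v) \<and> (\<mu>, snd w) \<in> S}"

lemma cylinder_subset: "cylinder A R S \<subseteq> joint_vals A"
  by (auto simp: cylinder_def)

lemma elapse_unit:
  "v \<in> vars A \<Longrightarrow> \<mu> \<in> var_vals A \<Longrightarrow> elapse A \<mu> (\<lambda>u. if u = v then 1 else 0) d = \<mu>(v := \<mu> v + d)"
  by (auto simp: elapse_def var_vals_def PiE_def extensional_def)

lemma fun_upd_in_joint_vals:
  "v \<in> vars A \<Longrightarrow> w \<in> joint_vals A \<Longrightarrow> ((fst w)(v := r), snd w) \<in> joint_vals A"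
  by (auto simp: joint_vals_def var_vals_def PiE_def extensional_def)

text \<open>Under rate 1 for \<open>v\<close> and 0 for all others, going into the past and then
  into the future sweeps exactly the line in direction \<open>v\<close>. Forgetting a variable thus
  reduces to closure under flows.\<close>

lemma cylinder_insert:
  assumes "S \<subseteq> joint_vals A" "v \<in> vars A"
  shows "cylinder A (insert v R) S =
    te_set A (tp_set A (cylinder A R S) (\<lambda>u. if u = v then 1 else 0)) (\<lambda>u. if u = v then 1 else 0)"
    (is "_ = te_set A (tp_set A ?X ?e) ?e")
proof -
  have "w \<in> te_set A (tp_set A ?X ?e) ?e \<longleftrightarrow> (\<exists>r. ((fst w)(v := r), snd w) \<in> ?X)"
    if w: "w \<in> joint_vals A" for w
  proof -
    have wv: "fst w \<in> var_vals A"
      using w by (auto simp: joint_vals_def)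
    have sub: "tp_set A ?X ?e \<subseteq> joint_vals A"
      using tp_set_eq[OF cylinder_subset] by blast
    have "w \<in> te_set A (tp_set A ?X ?e) ?e \<longleftrightarrow>
      (\<exists>d\<ge>0. (elapse A (fst w) ?e (- d), snd w) \<in> tp_set A ?X ?e)"
      using w by (simp only: te_set_eq_tp_set tp_set_eq[OF sub] elapse_minus) simp
    also have "\<dots> \<longleftrightarrow> (\<exists>d\<ge>0. \<exists>d'\<ge>0. (elapse A (fst w) ?e (- d + d'), snd w) \<in> ?X)"
      using w by (simp only: tp_set_eq[OF cylinder_subset] elapse_elapse)
        (auto simp: joint_vals_def elapse_in_var_vals elapse_elapse)
    also have "\<dots> \<longleftrightarrow> (\<exists>d. (elapse A (fst w) ?e d, snd w) \<in> ?X)"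
    proof
      assume "\<exists>d. (elapse A (fst w) ?e d, snd w) \<in> ?X"
      then obtain d where "(elapse A (fst w) ?e d, snd w) \<in> ?X" ..
      \<comment> \<open>A signed duration is split into its negative and its positive part.\<close>
      moreover have "d = - max 0 (- d) + max 0 d" by auto
      ultimately show "\<exists>d\<ge>0. \<exists>d'\<ge>0. (elapse A (fst w) ?e (- d + d'), snd w) \<in> ?X"
        by (metis max.cobounded1)
    qed blast
    also have "\<dots> \<longleftrightarrow> (\<exists>r. ((fst w)(v := r), snd w) \<in> ?X)"
      unfolding elapse_unit[OF assms(2) wv] by (metis add_diff_cancel_left' diff_add_cancel)
    finally show ?thesis .
  qed
  moreover have "w \<in> cylinder A (insert v R) S \<longleftrightarrow> (\<exists>r. ((fst w)(v := r), snd w) \<in> ?X)"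
    if w: "w \<in> joint_vals A" for w
  proof
    assume "w \<in> cylinder A (insert v R) S"
    then obtain \<mu> where \<mu>: "\<forall>u \<in> vars A - insert v R. \<mu> u = fst w u" "(\<mu>, snd w) \<in> S"
      by (auto simp: cylinder_def)
    then have "((fst w)(v := \<mu> v), snd w) \<in> ?X"
      using fun_upd_in_joint_vals[OF assms(2) w] by (auto simp: cylinder_def)
    then show "\<exists>r. ((fst w)(v := r), snd w) \<in> ?X" ..
  next
    assume "\<exists>r. ((fst w)(v := r), snd w) \<in> ?X"
    then obtain r \<mu> where "\<forall>u \<in> vars A - R. \<mu> u = ((fst w)(v := r)) u" "(\<mu>, snd w) \<in> S"
      by (auto simp: cylinder_def)
    then have "\<forall>u \<in> vars A - insert v R. \<mu> u = fst w u" "(\<mu>, snd w) \<in> S"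
      by auto
    then show "w \<in> cylinder A (insert v R) S"
      using w by (auto simp: cylinder_def)
  qed
  moreover have "te_set A (tp_set A ?X ?e) ?e \<subseteq> joint_vals A"
    by (auto simp: te_set_def tp_set_def joint_vals_def cylinder_def elapse_in_var_vals)
  ultimately show ?thesis
    using cylinder_subset[of A "insert v R" S] by blast
qed

lemma polyhedron_cylinder:
  assumes "finite (vars A)" "R \<subseteq> vars A" "parametric_polyhedron A S"
  shows "parametric_polyhedron A (cylinder A R S)"
proof -
  have "finite R" using assms by (auto intro: finite_subset)
  then show ?thesis
    using assms(2)
  proof (induction R)
    case empty
    have "\<mu> = \<mu>'" if "\<mu> \<in> var_vals A" "\<mu>' \<in> var_vals A" "\<forall>v \<in> vars A. \<mu> v = \<mu>' v" for \<mu> \<mu>'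
      using that by (auto simp: var_vals_def intro: PiE_ext)
    then have "cylinder A {} S = S"
      using polyhedron_subset[OF assms(3)] by (fastforce simp: cylinder_def joint_vals_def)
    then show ?case using assms by simp
  next
    case (insert v R)
    then show ?case
      using cylinder_insert[OF polyhedron_subset[OF assms(3)], of v R]
      by (simp add: polyhedron_tp_set polyhedron_te_set)
  qed
qed

lemma reset_in_var_vals: "reset A R \<mu> \<in> var_vals A"
  by (auto simp: reset_def var_vals_def)

text \<open>The values on \<open>R\<close> before the reset are forgotten and then fixed to 0, so
  the image is a cylinder cut by equations.\<close>

lemma reset_set_eq:
  assumes "S \<subseteq> joint_vals A" "R \<subseteq> vars A"
  shows "reset_set A S R = {w \<in> cylinder A R S. \<forall>v \<in> R. fst w v = 0}"
proof (intro equalityI subsetI)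
  fix w assume "w \<in> reset_set A S R"
  then obtain \<mu> where \<mu>: "(\<mu>, snd w) \<in> S" "fst w = reset A R \<mu>"
    by (auto simp: reset_set_def)
  then have "w \<in> joint_vals A" "\<forall>v \<in> vars A - R. \<mu> v = fst w v" "\<forall>v \<in> R. fst w v = 0"
    using assms reset_in_var_vals[of A R \<mu>]
    by (auto simp: joint_vals_def mem_Times_iff reset_def)
  then show "w \<in> {w \<in> cylinder A R S. \<forall>v \<in> R. fst w v = 0}"
    using \<mu>(1) by (auto simp: cylinder_def)
next
  fix w assume w: "w \<in> {w \<in> cylinder A R S. \<forall>v \<in> R. fst w v = 0}"
  then obtain \<mu> where \<mu>: "\<forall>v \<in> vars A - R. \<mu> v = fst w v" "(\<mu>, snd w) \<in> S" "fst w \<in> var_vals A"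
    by (auto simp: cylinder_def joint_vals_def)
  then have "reset A R \<mu> = fst w"
    using w by (auto simp: reset_def var_vals_def PiE_def extensional_def)
  then show "w \<in> reset_set A S R"
    using \<mu>(2) unfolding reset_set_def by (metis (mono_tags, lifting) mem_Collect_eq prod.collapse)
qed

lemma polyhedron_reset_set:
  assumes "finite (vars A)" "R \<subseteq> vars A" "parametric_polyhedron A S"
  shows "parametric_polyhedron A (reset_set A S R)"
  unfolding reset_set_eq[OF polyhedron_subset[OF assms(3)] assms(2)]
  using assms by (intro polyhedron_restrict[OF polyhedron_cylinder polyhedron_vars_eq])

text \<open>Projecting to the parameters amounts to forgetting every variable. This makes the
  cylinders passed to \<open>exhibit\<close> accessible to the closure results.\<close>

lemma times_par_proj_eq_cylinder:
  assumes "S \<subseteq> joint_vals A"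
  shows "var_vals A \<times> par_proj S = cylinder A (vars A) S"
proof -
  have "q \<in> par_vals A \<and> (\<exists>\<mu>. (\<mu>, q) \<in> S) \<longleftrightarrow> q \<in> par_proj S" for q
    using assms by (force simp: par_proj_def joint_vals_def)
  then show ?thesis
    by (simp add: cylinder_def joint_vals_def set_eq_iff)
qed

lemma polyhedron_times_par_proj:
  assumes "finite (vars A)" "parametric_polyhedron A S"
  shows "parametric_polyhedron A (var_vals A \<times> par_proj S)"
  unfolding times_par_proj_eq_cylinder[OF polyhedron_subset[OF assms(2)]]
  using assms by (intro polyhedron_cylinder) auto


section \<open>Reconstruction of runs\<close>

text \<open>An affine function of time is monotone, so its value at \<open>t\<close> lies between
  those at 0 and \<open>d\<close>, and every comparison with 0 holds on an interval.\<close>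

lemma cmp_zero_between:
  assumes "cmp_zero k x" "cmp_zero k (x + a * d)" "0 \<le> t" "t \<le> d"
  shows "cmp_zero k (x + a * t)"
proof (cases "0 \<le> a")
  case True
  then have "0 \<le> a * t" "a * t \<le> a * d"
    using assms by (simp_all add: mult_left_mono)
  then show ?thesis
    using assms(1,2) by (cases k) auto
next
  case False
  then have "a * t \<le> 0" "a * d \<le> a * t"
    using assms by (simp_all add: mult_nonpos_nonneg mult_left_mono_neg)
  then show ?thesis
    using assms(1,2) by (cases k) auto
qed

lemma sol_elapse_between:
  assumes "(\<mu>, q) \<in> sol A C" "(elapse A \<mu> f d, q) \<in> sol A C" "0 \<le> t" "t \<le> d"
  shows "(elapse A \<mu> f t, q) \<in> sol A C"
  using assms by (auto simp: sol_def elapse_in_var_vals lhs_elapse intro: cmp_zero_between)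

section \<open>Zones along a symbolic run\<close>

lemma edge_at_arc:
  assumes "symbolic_run A r" "k < length (snd r)"
  shows "edge_at r k \<in> edges A" "source (edge_at r k) = loc_at r k"
    "loc_at r (Suc k) = target (edge_at r k)" "zone_at r (Suc k) \<noteq> {}"
    "zone_at r (Suc k) = snd (post A (fst r ! k) (edge_at r k))"
proof -
  have "arc A (fst r ! k) (edge_at r k) (fst r ! Suc k)"
    using assms by (simp add: symbolic_run_def)
  then show "edge_at r k \<in> edges A" "source (edge_at r k) = loc_at r k"
    "loc_at r (Suc k) = target (edge_at r k)" "zone_at r (Suc k) \<noteq> {}"
    "zone_at r (Suc k) = snd (post A (fst r ! k) (edge_at r k))"
    by (auto simp: arc_def post_def Let_def)
qed

text \<open>Treats the initial zone and the later ones alike. Every point of a zone thus comes from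
  an entry valuation by a delay, which is what allows time elapsing to be cancelled.\<close>

lemma zone_at_eq:
  assumes "symbolic_run A r" "k \<le> length (snd r)"
  shows "zone_at r k =
    te_set A (entry_vals A r k \<inter> sol A (invariant A (loc_at r k))) (rate A (loc_at r k))
    \<inter> sol A (invariant A (loc_at r k))"
proof (cases k)
  case 0
  then show ?thesis
    using assms by (simp add: symbolic_run_def entry_vals_def init_sym_def Let_def)
next
  case (Suc j)
  then show ?thesis
    using edge_at_arc[OF assms(1), of j] assms(2) by (simp add: entry_vals_def post_def Let_def)
qed

lemma exhibit_polyhedron:
  assumes "exhibits_points A exhibit" "parametric_polyhedron A X" "X \<noteq> {}"
  obtains w where "exhibit X = Some w" "w \<in> X"
proof -
  have "\<exists>w \<in> X. exhibit X = Some w"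
    using assms unfolding exhibits_points_def by blast
  then show ?thesis using that by blast
qed

lemma exhibit_polyhedron_Diff:
  assumes "exhibits_points A exhibit" "parametric_polyhedron A X" "parametric_polyhedron A Y"
    "X - Y \<noteq> {}"
  obtains w where "exhibit (X - Y) = Some w" "w \<in> X - Y"
proof -
  have "\<exists>w \<in> X - Y. exhibit (X - Y) = Some w"
    using assms unfolding exhibits_points_def by blast
  then show ?thesis using that by blast
qed

section \<open>Backward reconstruction along a fixed symbolic run\<close>

context
  fixes A :: "('a, 'l, 'v, 'p) plma"
    and exhibit :: "('v, 'p) point_picker"
    and r :: "('a, 'l, 'v, 'p) sym_run"
  assumes plma: "is_plma A"
    and exhibits: "exhibits_points A exhibit"
    and run: "symbolic_run A r"
    and zone0: "zone_at r 0 \<noteq> {}"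
begin

lemma finite_vars: "finite (vars A)" and finite_params: "finite (params A)"
  using plma by (simp_all add: is_plma_def)

text \<open>Arcs guarantee this for all zones but the first, which \<open>zone0\<close>
  supplies.\<close>

lemma zone_at_nonempty: "k \<le> length (snd r) \<Longrightarrow> zone_at r k \<noteq> {}"
  using zone0 edge_at_arc(4)[OF run] by (cases k) auto

lemma loc_at_in_locations: "k \<le> length (snd r) \<Longrightarrow> loc_at r k \<in> locations A"
  using run plma edge_at_arc(1,3)[OF run]
  by (cases k) (auto simp: is_plma_def symbolic_run_def init_sym_def Let_def)

lemma resets_subset: "k < length (snd r) \<Longrightarrow> resets (edge_at r k) \<subseteq> vars A"
  using plma edge_at_arc(1)[OF run] by (auto simp: is_plma_def)

text \<open>The zone at \<open>k\<close> arises from the entry valuations at \<open>k\<close>, and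
  those at \<open>k + 1\<close> from the zone at \<open>k\<close>; the induction runs over the entry
  valuations.\<close>

lemma polyhedron_zone_at: "k \<le> length (snd r) \<Longrightarrow> parametric_polyhedron A (zone_at r k)"
  and polyhedron_entry_vals: "k \<le> length (snd r) \<Longrightarrow> parametric_polyhedron A (entry_vals A r k)"
proof -
  have zone: "parametric_polyhedron A (zone_at r k)"
    if "parametric_polyhedron A (entry_vals A r k)" "k \<le> length (snd r)" for k
    unfolding zone_at_eq[OF run that(2)]
    by (intro polyhedron_Int polyhedron_te_set polyhedron_sol that)
  have entry: "parametric_polyhedron A (entry_vals A r k)" if "k \<le> length (snd r)" for k
    using that
  proof (induction k)
    case 0
    then show ?case by (simp add: entry_vals_def polyhedron_init_vals plma)
  next
    case (Suc k)
    then have k: "k < length (snd r)" "k \<le> length (snd r)" by simp_all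
    have "parametric_polyhedron A (zone_at r k)"
      using zone[OF Suc.IH[OF k(2)] k(2)] .
    then have "parametric_polyhedron A
        (reset_set A (zone_at r k \<inter> sol A (guard (edge_at r k))) (resets (edge_at r k)))"
      by (intro polyhedron_reset_set finite_vars resets_subset k polyhedron_Int polyhedron_sol)
    then show ?case
      by (simp add: entry_vals_def)
  qed
  show "k \<le> length (snd r) \<Longrightarrow> parametric_polyhedron A (zone_at r k)"
    and "k \<le> length (snd r) \<Longrightarrow> parametric_polyhedron A (entry_vals A r k)"
    using zone entry by auto
qed

lemma zone_at_subset: "k \<le> length (snd r) \<Longrightarrow> zone_at r k \<subseteq> joint_vals A"
  using polyhedron_zone_at polyhedron_subset by blast

lemma zone_at_invariant: "k \<le> length (snd r) \<Longrightarrow> zone_at r k \<subseteq> sol A (invariant A (loc_at r k))"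
  using zone_at_eq[OF run] by blast

text \<open>The entry valuation from which \<open>w\<close> arose shows that the requested set is
  nonempty. The point returned may be another one, but it also reaches \<open>w\<close> by a
  delay.\<close>

lemma cancel_elapsing_succeeds:
  assumes k: "k \<le> length (snd r)" and w: "w \<in> zone_at r k"
  obtains u d where "cancel_elapsing A exhibit r k w = Some u"
    "u \<in> sol A (invariant A (loc_at r k)) \<inter> entry_vals A r k" "snd u = snd w"
    "0 \<le> d" "fst w = elapse A (fst u) (rate A (loc_at r k)) d"
proof -
  let ?f = "rate A (loc_at r k)" and ?I = "sol A (invariant A (loc_at r k))"
  let ?X = "tp_set A {w} ?f \<inter> ?I \<inter> entry_vals A r k"
  have wj: "w \<in> joint_vals A"
    using zone_at_subset[OF k] w by blast
  then have tp: "tp_set A {w} ?f = {u \<in> joint_vals A. \<exists>d\<ge>0. (elapse A (fst u) ?f d, snd u) = w}"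
    using tp_set_eq[of "{w}" A] by simp
  obtain \<mu> q d where "(\<mu>, q) \<in> entry_vals A r k \<inter> ?I" "0 \<le> d" "w = (elapse A \<mu> ?f d, q)"
    using w zone_at_eq[OF run k] by (auto simp: te_set_def)
  then have "(\<mu>, q) \<in> ?X"
    using sol_subset[of A] unfolding tp by force
  moreover have "parametric_polyhedron A ?X"
    by (intro polyhedron_Int polyhedron_tp_set polyhedron_singleton finite_vars finite_params wj
        polyhedron_sol polyhedron_entry_vals k)
  ultimately obtain u where u: "exhibit ?X = Some u" "u \<in> ?X"
    using exhibit_polyhedron[OF exhibits, of ?X] by blast
  then obtain d' where "0 \<le> d'" "(elapse A (fst u) ?f d', snd u) = w"
    unfolding tp by blast
  then show ?thesis
    using u by (intro that[of u d']) (auto simp: cancel_elapsing_def)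
qed

lemma discrete_pred_succeeds:
  assumes k: "k < length (snd r)" and w: "w \<in> entry_vals A r (Suc k)"
  obtains w' where "discrete_pred A exhibit r k w = Some w'"
    "w' \<in> zone_at r k \<inter> sol A (guard (edge_at r k))" "snd w' = snd w"
    "fst w = reset A (resets (edge_at r k)) (fst w')"
proof -
  let ?R = "resets (edge_at r k)" and ?Z = "zone_at r k \<inter> sol A (guard (edge_at r k))"
  let ?X = "{w' \<in> ?Z. snd w' = snd w \<and> (\<forall>v \<in> vars A - ?R. fst w' v = fst w v)}"
  obtain \<mu> where \<mu>: "(\<mu>, snd w) \<in> ?Z" "fst w = reset A ?R \<mu>"
    using w by (auto simp: entry_vals_def reset_set_def)
  then have "(\<mu>, snd w) \<in> ?X"
    by (auto simp: reset_def)
  moreover have "parametric_polyhedron A ?X"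
    using k by (intro polyhedron_restrict[OF polyhedron_Int[OF polyhedron_zone_at polyhedron_sol]]
      polyhedron_conj[OF polyhedron_snd_eq polyhedron_vars_eq] finite_vars finite_params) auto
  ultimately obtain w' where w': "exhibit ?X = Some w'" "w' \<in> ?X"
    using exhibit_polyhedron[OF exhibits, of ?X] by blast
  \<comment> \<open>Off \<open>?R\<close> the valuations agree by the choice of \<open>w'\<close>;
    on \<open>?R\<close> the valuation \<open>fst w\<close> vanishes, being the reset of
    \<mu>.\<close>
  moreover have "fst w = reset A ?R (fst w')"
    using w'(2) \<mu>(2) by (auto simp: reset_def)
  ultimately show ?thesis
    using that by (simp add: discrete_pred_def)
qed

text \<open>If all rates vanish, the duration is not determined by its endpoints; the chosen one is
  still admissible.\<close>

lemma elapsed_time_eq: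
  assumes "0 \<le> d" "\<mu>' = elapse A \<mu> f d"
  shows "0 \<le> elapsed_time A f \<mu> \<mu>'" "\<mu>' = elapse A \<mu> f (elapsed_time A f \<mu> \<mu>')"
  using someI[of "\<lambda>d. d \<ge> 0 \<and> \<mu>' = elapse A \<mu> f d" d] assms by (auto simp: elapsed_time_def)

text \<open>The accumulator \<open>xs\<close> is already a valid suffix. Each round prepends one
  delay and one edge and keeps the parameters, until position 0, where entry valuations are
  initial.\<close>

lemma reconstruct_back_succeeds:
  assumes "k \<le> length (snd r)" "w \<in> sol A (invariant A (loc_at r k)) \<inter> entry_vals A r k"
    and "concrete_steps A (snd w) (loc_at r k, fst w) xs"
  shows "\<exists>\<rho>. reconstruct_back A exhibit r k w xs = Some \<rho> \<and> concrete_run A (snd w) \<rho>"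
  using assms
proof (induction k arbitrary: w xs)
  case 0
  then have "initial_state A (snd w) (loc_at r 0, fst w)"
    using loc_at_in_locations[of 0] run
    by (simp add: initial_state_def is_state_def entry_vals_def init_vals_def symbolic_run_def
        init_sym_def Let_def)
  then show ?case
    using 0 by (simp add: concrete_run_def)
next
  case (Suc k)
  let ?e = "edge_at r k" and ?f = "rate A (loc_at r k)" and ?I = "sol A (invariant A (loc_at r k))"
  have k: "k < length (snd r)" using Suc.prems by simp
  note edge = edge_at_arc[OF run k]
  obtain w' where w': "discrete_pred A exhibit r k w = Some w'"
    "w' \<in> zone_at r k \<inter> sol A (guard ?e)" "snd w' = snd w" "fst w = reset A (resets ?e) (fst w')"
    using discrete_pred_succeeds[OF k] Suc.prems(2) by blast
  obtain u d where u: "cancel_elapsing A exhibit r k w' = Some u" "u \<in> ?I \<inter> entry_vals A r k"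
    "snd u = snd w'" "0 \<le> d" "fst w' = elapse A (fst u) ?f d"
    using cancel_elapsing_succeeds[of k w'] k w'(2) by auto
  define t where "t = elapsed_time A ?f (fst u) (fst w')"
  have t: "0 \<le> t" "fst w' = elapse A (fst u) ?f t"
    using elapsed_time_eq[OF u(4,5)] by (simp_all add: t_def)
  have w'I: "w' \<in> ?I"
    using w'(2) zone_at_invariant[of k] k by auto
  have loc: "loc_at r k \<in> locations A" "loc_at r (Suc k) \<in> locations A"
    using k by (simp_all add: loc_at_in_locations)
  \<comment> \<open>Both ends of the delay satisfy the invariant, hence by convexity so does every
    point in between.\<close>
  have "(elapse A (fst u) ?f t', snd u) \<in> ?I" if "0 \<le> t'" "t' \<le> t" for t'
    using that u(2,3) w'I t sol_elapse_between[of "fst u" "snd u" A _ ?f t t']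
    by (metis IntD1 prod.collapse)
  then have "delay_step A (snd u) (loc_at r k, fst u) t (loc_at r k, fst w')"
    using t loc by (simp add: delay_step_def is_state_def)
  moreover have "discrete_step A (snd u) (loc_at r k, fst w') ?e (loc_at r (Suc k), fst w)"
    using edge(1-3) loc w'(2-4) w'I u(3) Suc.prems(2)
    by (cases w, cases w') (simp add: discrete_step_def is_state_def)
  ultimately have "concrete_steps A (snd u) (loc_at r k, fst u) (((t, ?e), (loc_at r (Suc k), fst w)) # xs)"
    using Suc.prems(3) u(3) w'(3) by auto
  from Suc.IH[OF _ u(2) this] k u(3) w'(3) show ?case
    by (simp add: w'(1) u(1) t_def Let_def)
qed

lemma reconstruct_pos_succeeds:
  assumes "i \<le> length (snd r)" "w \<in> zone_at r i"
  obtains \<rho> where "reconstruct_pos A exhibit r i w = Some \<rho>" "concrete_run A (snd w) \<rho>"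
proof -
  obtain u d where "cancel_elapsing A exhibit r i w = Some u"
    "u \<in> sol A (invariant A (loc_at r i)) \<inter> entry_vals A r i" "snd u = snd w"
    using cancel_elapsing_succeeds[OF assms] by metis
  then show ?thesis
    using reconstruct_back_succeeds[OF assms(1), of u "[]"] that by (auto simp: reconstruct_pos_def)
qed

section \<open>Termination of the deadlock searches\<close>

lemma pos_then_neg_succeeds:
  assumes "i \<le> length (snd r)" "w \<in> zone_at r i"
  obtains \<rho> where "pos_then_neg A exhibit r i w = Some \<rho>"
proof -
  obtain \<rho> where "reconstruct_pos A exhibit r i w = Some \<rho>"
    using reconstruct_pos_succeeds[OF assms] .
  then show ?thesis
    using that by (simp add: pos_then_neg_def)
qed

lemma parametric_deadlock_runs_succeeds: "\<exists>N. parametric_deadlock_runs A exhibit r = Some N"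
proof -
  define found where
    "found = (\<lambda>i. i < length (snd r) \<and> par_proj (zone_at r (Suc i)) \<subset> par_proj (zone_at r i))"
  have unfold: "parametric_deadlock_runs A exhibit r =
    (if \<exists>i. found i then
       let i = (LEAST i. found i) in
       do {
         u \<leftarrow> exhibit (var_vals A \<times> (par_proj (zone_at r i) - par_proj (zone_at r (Suc i))));
         w \<leftarrow> exhibit {w \<in> zone_at r i. snd w = snd u};
         \<rho> \<leftarrow> pos_then_neg A exhibit r i w;
         Some {\<rho>}
       }
     else Some {})"
    unfolding parametric_deadlock_runs_def Let_def found_def ..
  show ?thesis
  proof (cases "\<exists>i. found i")
    case False
    then show ?thesis by (simp add: unfold)
  next
    case True
    define i where "i = (LEAST i. found i)"
    have "found i"
      using True unfolding i_def by (rule LeastI_ex)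
    then have i: "i < length (snd r)" and strict: "par_proj (zone_at r (Suc i)) \<subset> par_proj (zone_at r i)"
      by (simp_all add: found_def)
    let ?P = "\<lambda>k. var_vals A \<times> par_proj (zone_at r k)"
    let ?X = "var_vals A \<times> (par_proj (zone_at r i) - par_proj (zone_at r (Suc i)))"
    \<comment> \<open>The cylinder over a difference is the difference of two cylinders, a shape on
      which \<open>exhibit\<close> returns.\<close>
    have X: "?X = ?P i - ?P (Suc i)" by auto
    have "?X \<noteq> {}"
      using strict by (auto simp: var_vals_def PiE_eq_empty_iff)
    then obtain u where u: "exhibit ?X = Some u" "u \<in> ?X"
      using exhibit_polyhedron_Diff[OF exhibits polyhedron_times_par_proj polyhedron_times_par_proj]
        finite_vars polyhedron_zone_at i unfolding X by (metis Suc_leI less_imp_le)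
    let ?Y = "{w \<in> zone_at r i. snd w = snd u}"
    have "?Y \<noteq> {}"
      using u(2) by (force simp: par_proj_def)
    moreover have "parametric_polyhedron A ?Y"
      using i by (intro polyhedron_restrict[OF polyhedron_zone_at polyhedron_snd_eq] finite_params) auto
    ultimately obtain w where w: "exhibit ?Y = Some w" "w \<in> ?Y"
      using exhibit_polyhedron[OF exhibits] by blast
    obtain \<rho> where "pos_then_neg A exhibit r i w = Some \<rho>"
      using pos_then_neg_succeeds[of i w] i w(2) by auto
    then show ?thesis
      using True u(1) w(1)
      by (simp add: unfold Let_def flip: i_def)
  qed
qed

text \<open>The blocked set is a slice of a zone minus a polyhedron, and it is nonempty at the index
  found.\<close>

lemma nonparametric_deadlock_runs_succeeds:
  "\<exists>N. nonparametric_deadlock_runs A exhibit r q = Some N"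
proof -
  define blocked where "blocked = (\<lambda>i. {w \<in> zone_at r i. snd w = q} -
    (tp_set A (sol A (guard (edge_at r i))) (rate A (loc_at r i)) \<inter> sol A (invariant A (loc_at r i))))"
  define found where "found = (\<lambda>i. i < length (snd r) \<and> blocked i \<noteq> {})"
  have unfold: "nonparametric_deadlock_runs A exhibit r q =
    (if \<exists>i. found i then
       do {
         w \<leftarrow> exhibit (blocked (LEAST i. found i));
         \<rho> \<leftarrow> pos_then_neg A exhibit r (LEAST i. found i) w;
         Some {\<rho>}
       }
     else Some {})"
    unfolding nonparametric_deadlock_runs_def Let_def found_def blocked_def ..
  show ?thesis
  proof (cases "\<exists>i. found i")
    case False
    then show ?thesis by (simp add: unfold)
  next
    case True
    define i where "i = (LEAST i. found i)"
    have "found i"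
      using True unfolding i_def by (rule LeastI_ex)
    then have i: "i < length (snd r)" and ne: "blocked i \<noteq> {}"
      by (simp_all add: found_def)
    have "parametric_polyhedron A {w \<in> zone_at r i. snd w = q}"
      using i by (intro polyhedron_restrict[OF polyhedron_zone_at polyhedron_snd_eq] finite_params) auto
    moreover have "parametric_polyhedron A (tp_set A (sol A (guard (edge_at r i))) (rate A (loc_at r i))
        \<inter> sol A (invariant A (loc_at r i)))"
      by (intro polyhedron_Int polyhedron_tp_set polyhedron_sol)
    ultimately obtain w where w: "exhibit (blocked i) = Some w" "w \<in> blocked i"
      using exhibit_polyhedron_Diff[OF exhibits] ne unfolding blocked_def by blast
    then obtain \<rho> where "pos_then_neg A exhibit r i w = Some \<rho>"
      using pos_then_neg_succeeds[of i w] i by (auto simp: blocked_def)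
    then show ?thesis
      using True w(1) by (simp add: unfold flip: i_def)
  qed
qed

text \<open>The positive run comes from a point of the last zone; for the two deadlock searches it
  is enough that they return.\<close>

lemma exemplify3_succeeds:
  "\<exists>runs. exemplify3 A exhibit r = Some runs \<and> (\<exists>\<rho> \<in> runs. \<exists>q \<in> par_vals A. concrete_run A q \<rho>)"
proof -
  let ?n = "length (snd r)"
  obtain w where w: "exhibit (zone_at r ?n) = Some w" "w \<in> zone_at r ?n"
    using exhibit_polyhedron[OF exhibits polyhedron_zone_at zone_at_nonempty] by blast
  obtain \<rho> where \<rho>: "reconstruct_pos A exhibit r ?n w = Some \<rho>" "concrete_run A (snd w) \<rho>"
    using reconstruct_pos_succeeds w(2) by blast
  obtain N1 where N1: "parametric_deadlock_runs A exhibit r = Some N1"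
    using parametric_deadlock_runs_succeeds by blast
  obtain N2 where N2: "nonparametric_deadlock_runs A exhibit r (snd w) = Some N2"
    using nonparametric_deadlock_runs_succeeds by blast
  have "snd w \<in> par_vals A"
    using zone_at_subset[of ?n] w(2) by (auto simp: joint_vals_def)
  then show ?thesis
    using w(1) \<rho> N1 N2 by (auto simp: exemplify3_def)
qed

end


section \<open>Breadth-first exploration\<close>

inductive_set symbolic_states ::
    "('a, 'l, 'v, 'p) plma \<Rightarrow> ('l, 'v, 'p) sym_state set" for A where
  init: "init_sym A \<in> symbolic_states A"
| step: "s \<in> symbolic_states A \<Longrightarrow> arc A s e s' \<Longrightarrow> s' \<in> symbolic_states A"

lemma symbolic_state_imp_run: "s \<in> symbolic_states A \<Longrightarrow> \<exists>r. symbolic_run_to A s r"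
proof (induction rule: symbolic_states.induct)
  case init
  have "symbolic_run_to A (init_sym A) ([init_sym A], [])"
    by (simp add: symbolic_run_to_def symbolic_run_def)
  then show ?case ..
next
  case (step s e s')
  then obtain ss es where r: "symbolic_run_to A s (ss, es)" by auto
  then have len: "length ss = Suc (length es)" and last: "last ss = s"
    by (auto simp: symbolic_run_to_def symbolic_run_def)
  then have "ss ! length es = s"
    using last_conv_nth[of ss] by fastforce
  then have "symbolic_run_to A s' (ss @ [s'], es @ [e])"
    using r step.hyps(2) len
    by (auto simp: symbolic_run_to_def symbolic_run_def nth_append less_Suc_eq)
  then show ?case ..
qed

lemma symbolic_state_zone:
  "s \<in> symbolic_states A \<Longrightarrow>
   \<exists>S. snd s = te_set A S (rate A (fst s)) \<inter> sol A (invariant A (fst s))"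
  by (erule symbolic_states.cases) (auto simp: init_sym_def arc_def post_def Let_def)

text \<open>A zone is closed under time elapsing within its invariant, because two successive delays
  add up to one.\<close>

lemma symbolic_state_elapse:
  assumes "s \<in> symbolic_states A" "(\<mu>, q) \<in> snd s" "0 \<le> d"
    and "(elapse A \<mu> (rate A (fst s)) d, q) \<in> sol A (invariant A (fst s))"
  shows "(elapse A \<mu> (rate A (fst s)) d, q) \<in> snd s"
proof -
  obtain S where S: "snd s = te_set A S (rate A (fst s)) \<inter> sol A (invariant A (fst s))"
    using symbolic_state_zone[OF assms(1)] ..
  then obtain \<mu>0 d0 where \<mu>0: "\<mu> = elapse A \<mu>0 (rate A (fst s)) d0" "(\<mu>0, q) \<in> S" "0 \<le> d0"
    using assms(2) by (auto simp: te_set_def)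
  then have "elapse A \<mu> (rate A (fst s)) d = elapse A \<mu>0 (rate A (fst s)) (d0 + d)" "0 \<le> d0 + d"
    using assms(3) by (simp_all add: elapse_elapse)
  then have "(elapse A \<mu> (rate A (fst s)) d, q) \<in> te_set A S (rate A (fst s))"
    using \<mu>0(2) unfolding te_set_def by blast
  then show ?thesis
    using S assms(4) by blast
qed

lemma subset_te_set: "(\<mu>, q) \<in> S \<Longrightarrow> \<mu> \<in> var_vals A \<Longrightarrow> (\<mu>, q) \<in> te_set A S f"
  unfolding te_set_def using elapse_0[of \<mu> A f] by force

lemma initial_state_in_init_sym:
  assumes "initial_state A q s"
  shows "fst s = fst (init_sym A)" "(snd s, q) \<in> snd (init_sym A)"
proof -
  show "fst s = fst (init_sym A)"
    using assms by (simp add: initial_state_def init_sym_def Let_def)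
  have "(snd s, q) \<in> sol A (invariant A (init_loc A))"
    using assms by (auto simp: initial_state_def is_state_def)
  moreover from this have "(snd s, q) \<in> init_vals A"
    using assms by (auto simp: initial_state_def init_vals_def sol_def)
  ultimately show "(snd s, q) \<in> snd (init_sym A)"
    by (auto simp: init_sym_def Let_def init_vals_def intro!: subset_te_set)
qed

lemma reachable_imp_init_nonempty: "reachable A q l \<Longrightarrow> snd (init_sym A) \<noteq> {}"
  unfolding reachable_def concrete_run_def using initial_state_in_init_sym(2) by blast

text \<open>A delay stays inside the current zone and the edge leads into its \<open>post\<close>.
  The concrete state reached shows that this \<open>post\<close> is nonempty, so the arc
  exists.\<close>

lemma concrete_steps_in_symbolic_states:
  assumes "concrete_steps A q s xs" "(fst s, Z) \<in> symbolic_states A" "(snd s, q) \<in> Z"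
    and "t \<in> snd ` set xs"
  shows "\<exists>Z. (fst t, Z) \<in> symbolic_states A"
  using assms
proof (induction xs arbitrary: s Z)
  case Nil
  then show ?case by simp
next
  case (Cons x xs)
  let ?f = "rate A (fst s)" and ?e = "snd (fst x)"
  obtain u where u: "delay_step A q s (fst (fst x)) u" "discrete_step A q u ?e (snd x)"
    using Cons.prems(1) by auto
  have u_eq: "u = (fst s, elapse A (snd s) ?f (fst (fst x)))" and d: "0 \<le> fst (fst x)"
    using u(1) by (simp_all add: delay_step_def)
  have edge: "?e \<in> edges A" "source ?e = fst s" "snd x = (target ?e, reset A (resets ?e) (snd u))"
    "(snd u, q) \<in> sol A (guard ?e)"
    and inv: "(snd u, q) \<in> sol A (invariant A (fst s))"
      "(snd (snd x), q) \<in> sol A (invariant A (target ?e))"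
    using u(2) by (auto simp: discrete_step_def is_state_def u_eq)
  have "(snd u, q) \<in> Z"
    using symbolic_state_elapse[OF Cons.prems(2), of "snd s" q "fst (fst x)"] Cons.prems(3) d inv(1)
    by (simp add: u_eq)
  then have "(snd (snd x), q) \<in> reset_set A (Z \<inter> sol A (guard ?e)) (resets ?e)"
    using edge(3,4) by (auto simp: reset_set_def)
  then have mem: "(snd (snd x), q) \<in> snd (post A (fst s, Z) ?e)"
    using inv(2) edge(3) by (auto simp: post_def Let_def reset_in_var_vals intro!: subset_te_set)
  then have "arc A (fst s, Z) ?e (post A (fst s, Z) ?e)"
    using edge(1,2) by (auto simp: arc_def)
  then have "post A (fst s, Z) ?e \<in> symbolic_states A"
    using Cons.prems(2) symbolic_states.step by metis
  moreover have "fst (post A (fst s, Z) ?e) = fst (snd x)"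
    by (simp add: post_def Let_def edge(3))
  ultimately have sym: "(fst (snd x), snd (post A (fst s, Z) ?e)) \<in> symbolic_states A"
    by (metis prod.collapse)
  show ?case
    using Cons.IH[OF _ sym mem] Cons.prems(1,4) sym by auto
qed

lemma reachable_imp_symbolic_state:
  assumes "reachable A q l"
  shows "\<exists>Z. (l, Z) \<in> symbolic_states A"
proof -
  obtain \<rho> t where \<rho>: "concrete_run A q \<rho>" and t: "l = fst t" "t \<in> run_states \<rho>"
    using assms unfolding reachable_def by blast
  obtain s xs where "\<rho> = (s, xs)" by (cases \<rho>)
  then have init: "initial_state A q s" and steps: "concrete_steps A q s xs"
    and t: "l = fst t" "t = s \<or> t \<in> snd ` set xs"
    using \<rho> t by (simp_all add: concrete_run_def run_states_def)
  have sym: "(fst s, snd (init_sym A)) \<in> symbolic_states A"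
    using initial_state_in_init_sym(1)[OF init] symbolic_states.init by simp
  show ?thesis
    using concrete_steps_in_symbolic_states[OF steps sym initial_state_in_init_sym(2)[OF init]] t sym
    by blast
qed

section \<open>Invariant and termination of the exploration\<close>

definition bfs_invariant ::
    "('a, 'l, 'v, 'p) plma \<Rightarrow>
     ('l, 'v, 'p) sym_state set \<times> ('l, 'v, 'p) sym_state list \<Rightarrow> bool" where
  "bfs_invariant A c \<longleftrightarrow>
     init_sym A \<in> fst c \<and> set (snd c) \<subseteq> fst c \<and> fst c \<subseteq> symbolic_states A \<and>
     (\<forall>s \<in> fst c - set (snd c). fst s \<notin> accepting A \<and> (\<forall>e s'. arc A s e s' \<longrightarrow> s' \<in> fst c))"

lemma snd_bfs_step: "\<exists>new. bfs_step A es c = (fst c \<union> set new, tl (snd c) @ new)"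
  by (auto simp: bfs_step_def Let_def)

lemma fst_bfs_step:
  assumes "set es = edges A"
  shows "fst (bfs_step A es c) = fst c \<union> {s'. \<exists>e. arc A (hd (snd c)) e s'}"
  using assms by (auto simp: bfs_step_def Let_def arc_def)

lemma bfs_invariant_step:
  assumes "set es = edges A" "bfs_invariant A c" "bfs_continue A c"
  shows "bfs_invariant A (bfs_step A es c)"
proof -
  obtain x q where q: "snd c = x # q"
    using assms(3) by (cases "snd c") (auto simp: bfs_continue_def)
  obtain new where new: "bfs_step A es c = (fst c \<union> set new, q @ new)"
    using snd_bfs_step[of A es c] q by auto
  have succ: "fst c \<union> set new = fst c \<union> {s'. \<exists>e. arc A x e s'}"
    using fst_bfs_step[OF assms(1), of c] new q by simp
  have x: "x \<in> symbolic_states A" "fst x \<notin> accepting A"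
    using assms(2,3) q by (auto simp: bfs_invariant_def bfs_continue_def)
  have "fst c \<union> set new \<subseteq> symbolic_states A"
    using succ assms(2) symbolic_states.step[OF x(1)] by (auto simp: bfs_invariant_def)
  \<comment> \<open>A state outside the new queue is either \<open>x\<close>, whose successors have
    just been added, or was processed before.\<close>
  moreover have "fst s \<notin> accepting A \<and> (\<forall>e s'. arc A s e s' \<longrightarrow> s' \<in> fst c \<union> set new)"
    if "s \<in> fst c \<union> set new - set (q @ new)" for s
  proof (cases "s = x")
    case True
    then show ?thesis using x(2) succ by auto
  next
    case False
    then have "s \<in> fst c - set (snd c)"
      using that q by auto
    then show ?thesis
      using assms(2) unfolding bfs_invariant_def by blast
  qed
  moreover have "init_sym A \<in> fst c \<union> set new" "set (q @ new) \<subseteq> fst c \<union> set new"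
    using assms(2) q by (auto simp: bfs_invariant_def)
  ultimately show ?thesis
    unfolding bfs_invariant_def new fst_conv snd_conv by blast
qed

text \<open>With an empty queue all discovered states are processed. They contain the initial state
  and are closed under arcs, hence they are all symbolic states.\<close>

lemma bfs_invariant_exhausted:
  assumes "bfs_invariant A c" "snd c = []" "s \<in> symbolic_states A"
  shows "fst s \<notin> accepting A"
proof -
  have "s \<in> fst c"
    using assms(3) by induction (use assms(1,2) in \<open>auto simp: bfs_invariant_def\<close>)
  then show ?thesis
    using assms(1,2) by (auto simp: bfs_invariant_def)
qed

text \<open>
  Every step removes one state from the front of the queue and adds states only at its end. If the
  loop ran forever, each discovered state would thus come to the front, and with it, by induction
  along arcs, each symbolic state, including an accepting one.
\<close>

lemma bfs_loop_stops:
  assumes es: "set es = edges A" and s: "s \<in> symbolic_states A" "fst s \<in> accepting A"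
  shows "\<exists>k. \<not> bfs_continue A ((bfs_step A es ^^ k) ({init_sym A}, [init_sym A]))"
proof (rule ccontr)
  define c where "c = (\<lambda>k. (bfs_step A es ^^ k) ({init_sym A}, [init_sym A]))"
  assume "\<not> (\<exists>k. \<not> bfs_continue A ((bfs_step A es ^^ k) ({init_sym A}, [init_sym A])))"
  then have cont: "snd (c k) \<noteq> []" "fst (hd (snd (c k))) \<notin> accepting A" for k
    by (auto simp: c_def bfs_continue_def)
  have c_Suc: "c (Suc k) = bfs_step A es (c k)" for k
    by (simp add: c_def)
  have queue: "\<exists>m. snd (c k) ! j = hd (snd (c m))" if "j < length (snd (c k))" for j k
    using that
  proof (induction j arbitrary: k)
    case 0
    then show ?case using cont(1) hd_conv_nth by metis
  next
    case (Suc j)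
    obtain new where "snd (c (Suc k)) = tl (snd (c k)) @ new"
      using snd_bfs_step[of A es "c k"] c_Suc by auto
    moreover have "j < length (tl (snd (c k)))"
      using Suc.prems by simp
    ultimately have "snd (c (Suc k)) ! j = snd (c k) ! Suc j" "j < length (snd (c (Suc k)))"
      by (simp_all add: nth_append nth_tl)
    then show ?case
      using Suc.IH by metis
  qed
  have discovered: "\<exists>m. x = hd (snd (c m))" if "x \<in> fst (c k)" for x k
    using that
  proof (induction k)
    case 0
    then have "x = hd (snd (c 0))" by (simp add: c_def)
    then show ?case ..
  next
    case (Suc k)
    obtain new where "c (Suc k) = (fst (c k) \<union> set new, tl (snd (c k)) @ new)"
      using snd_bfs_step[of A es "c k"] c_Suc by auto
    then have "x \<in> fst (c k) \<or> x \<in> set (snd (c (Suc k)))"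
      using Suc.prems by auto
    then show ?case
      using Suc.IH queue by (metis in_set_conv_nth)
  qed
  have "\<exists>m. s = hd (snd (c m))"
    using s(1)
  proof induction
    case init
    show ?case by (rule discovered[of _ 0]) (simp add: c_def)
  next
    case (step x e x')
    then obtain m where "x = hd (snd (c m))" by blast
    then have "x' \<in> fst (c (Suc m))"
      using step.hyps fst_bfs_step[OF es] by (auto simp: c_Suc)
    then show ?case by (rule discovered)
  qed
  then show False
    using cont(2) s(2) by auto
qed

text \<open>The zone graph may be infinite, so termination rests on the accepting state alone:
  \<open>while_option\<close> returns as soon as some iterate violates the loop condition.\<close>

lemma bfs_terminates:
  assumes "set es = edges A" "s \<in> symbolic_states A" "fst s \<in> accepting A"
  obtains c where "bfs A es = Some c" "bfs_invariant A c"
proof -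
  obtain c where c: "bfs A es = Some c"
    using bfs_loop_stops[OF assms] by (auto simp: bfs_def while_option_def)
  have "bfs_invariant A ({init_sym A}, [init_sym A])"
    by (simp add: bfs_invariant_def symbolic_states.init)
  then have "bfs_invariant A c"
    using while_option_rule[of "bfs_invariant A", OF bfs_invariant_step[OF assms(1)] c[unfolded bfs_def]]
    by blast
  then show ?thesis
    using that c by blast
qed

section \<open>Termination and positive output of the whole algorithm\<close>

theorem proposition1:
  fixes A :: "('a, 'l, 'v, 'p) plma"
    and pv :: "'p par_val"
    and lT :: 'l
    and es :: "('a, 'l, 'v, 'p) edge list"
    and pick :: "('l, 'v, 'p) sym_state \<Rightarrow> ('a, 'l, 'v, 'p) sym_run"
    and exhibit :: "('v, 'p) point_picker"
  assumes "is_plma A"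
    and "pv \<in> par_vals A"
    and "lT \<in> accepting A"
    and "reachable A pv lT"
    and "set es = edges A"
    and "\<And>s. \<exists>r. symbolic_run_to A s r \<Longrightarrow> shortest_symbolic_run_to A s (pick s)"
    and "exhibits_points A exhibit"
  shows "\<exists>runs. exemplify A es pick exhibit = Some runs \<and>
           (\<exists>\<rho> \<in> runs. \<exists>pv' \<in> par_vals A. concrete_run A pv' \<rho>)"
proof -
  note plma = assms(1)
  obtain Z where target: "(lT, Z) \<in> symbolic_states A"
    using reachable_imp_symbolic_state[OF assms(4)] by auto
  have init: "snd (init_sym A) \<noteq> {}"
    using reachable_imp_init_nonempty[OF assms(4)] .
  obtain c where c: "bfs A es = Some c" and inv: "bfs_invariant A c"
    using bfs_terminates[OF assms(5) target] assms(3) by auto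
  \<comment> \<open>An empty queue would mean that no symbolic state is accepting, against
    \<open>(lT, Z)\<close>.\<close>
  have "snd c \<noteq> []"
  proof
    assume "snd c = []"
    then show False
      using bfs_invariant_exhausted[OF inv _ target] assms(3) by simp
  qed
  then obtain s q where sq: "snd c = s # q" by (cases "snd c") auto
  have s: "s \<in> symbolic_states A"
    using inv sq by (auto simp: bfs_invariant_def)
  \<comment> \<open>The state \<open>s\<close> may differ from \<open>(lT, Z)\<close>, but it too is
    a symbolic state and so has a run, which is the condition under which \<open>pick\<close> is
    specified.\<close>
  have run: "symbolic_run A (pick s)"
    using assms(6)[OF symbolic_state_imp_run[OF s]]
    by (auto simp: shortest_symbolic_run_to_def symbolic_run_to_def)
  have zone0: "zone_at (pick s) 0 \<noteq> {}"
    using run init by (simp add: symbolic_run_def)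
  obtain runs \<rho> pv' where "exemplify3 A exhibit (pick s) = Some runs" "\<rho> \<in> runs"
      "pv' \<in> par_vals A" "concrete_run A pv' \<rho>"
    using exemplify3_succeeds[OF plma assms(7) run zone0] by blast
  then show ?thesis
    by (auto simp: exemplify_def c sq)
qed

end
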